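(* Let $r_t:[\underline{\tau},\overline{\tau}]\to\mathbb{R}^2$, $t\in[\underline{t},\overline{t}]$, be a $1$-parameter family of closed convex curves such that $r_t(\tau)$ is a $C^3$-class function of $\tau$, and this function and all its derivatives with respect to $\tau$ (up to order three) depend continuously on $t$. Let $E_t:[\underline{\tau},\overline{\tau}]\to\mathbb{R}^2$ denote the evolute of $r_t$. Let $o:[\underline{t},\overline{t}]\to\mathbb{R}^2$ be a continuous curve that transversely intersects $E_t$ at $E_{t^{\star}}(\tau_0)=o(t^{\star})$, and let $N(o(t))$ denote the number of global equilibrium points of $r_t$ with respect to $o(t)$, and $N^0(o(t))$ the sum of the imaginary equilibrium indices of $r_t$ with respect to $o(t)$. Assume that $E_{t^{\star}}(\tau_0)$ is a general point of $E_{t^\star}$ and that $E_{t^{\star}}$ is locally convex at $E_{t^{\star}}(\tau_0)$. (i) If $o(t)$ moves from the convex side of $E_{t^{\star}}$ to its concave side as $t$ increases, then $N(o(t))$ increases by $2$ at $t=t^{\star}$, $\lim_{t\to t^{\star}-0}N^0(o(t))$ is a (finite) constant, and $\lim_{t\to t^{\star}+0}N^0(o(t))=\infty$. (ii) If $o(t)$ moves from the concave side of $E_{t^{\star}}$ to its convex side as $t$ increases, then $N(o(t))$ decreases by $2$ at $t=t^{\star}$, $\lim_{t\to t^{\star}-0}N^0(o(t))=\infty$, and $\lim_{t\to t^{\star}+0}N^0(o(t))$ is a (finite) constant.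
   Context: The evolute of a plane curve is the curve of its centers of curvature. A point $E_t(\tau)$ of $E_t$ is general if it is not a cusp of $E_t$, and $E_t(\tau')\neq E_t(\tau)$ for any $\tau'\neq\tau$. $E_t$ is locally convex at a general point $E_t(\tau)$ if $E_t(\tau)$ has a neighborhood $V$ in $\mathbb{R}^2$ such that $E_t\cap V$ is a strictly convex curve; for such $V$, the convex, connected region of $(\mathbb{R}^2\setminus E_t)\cap V$ is the convex side of $E_t$ at $E_t(\tau)$, and the other region is the concave side. A (global) equilibrium point of a curve $r$ with respect to a point $q$ is a point $m=r(\tau)$ that is a critical point of the distance function $\tau\mapsto|r(\tau)-q|$. If $m_1,\dots,m_N$ are the (non-degenerate) equilibrium points of $r$ with respect to $q$, put $\rho_i=|m_i-q|$ and let $\kappa_i$ be the signed curvature of $r$ at $m_i$, the sign being taken with respect to the normal vector $(m_i-q)/\rho_i$ (so $\kappa_i<0$ if the curve bends toward $q$ at $m_i$; $m_i$ is non-degenerate iff $1+\kappa_i\rho_i\ne0$). The imaginary equilibrium indices associated with $m_i$ are $$S_i^0=\frac{1}{|\kappa_i\rho_i+1|},\qquad U_i^0=\frac{|\kappa_i\rho_i|}{|\kappa_i\rho_i+1|},$$ and their sum is $N^0(q)=\sum_{i=1}^{N}(S_i^0+U_i^0)$.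
   Formalization: The sides crossed by o(t) are those of the moving E_t, not of the fixed E_{t*} (false if r_t translates faster than o). Also: r_t is regular, of nonzero curvature, C³ at its closing point; continuity is joint in (t,τ); cusp means E_t'=0; if o(t) lies on r_t it counts as an equilibrium. *)

theory Defs
  imports "HOL-Analysis.Analysis"
begin

section \<open>Closed convex curves, curvature, evolute\<close>

text \<open>
  A closed curve parametrised over \<open>[a, b]\<close> is represented by its \<open>(b - a)\<close>-periodic
  extension to the real line, so that smoothness at the closing point is ordinary smoothness and
  \<open>{a..<b}\<close> lists every parameter once.
\<close>

definition D :: "nat \<Rightarrow> (real \<Rightarrow> real^2) \<Rightarrow> real \<Rightarrow> real^2" where
  "D k c = ((\<lambda>f x. vector_derivative f (at x)) ^^ k) c"

definition C3_curve :: "(real \<Rightarrow> real^2) \<Rightarrow> bool" where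
  "C3_curve c \<longleftrightarrow>
     (\<forall>k<3. \<forall>x. D k c differentiable (at x)) \<and> continuous_on UNIV (D 3 c)"

definition closed_convex_curve :: "real \<Rightarrow> real \<Rightarrow> (real \<Rightarrow> real^2) \<Rightarrow> bool" where
  "closed_convex_curve a b c \<longleftrightarrow>
     (\<forall>x. c (x + (b - a)) = c x) \<and> inj_on c {a..<b} \<and>
     (\<exists>K. convex K \<and> compact K \<and> interior K \<noteq> {} \<and> c ` {a..b} = frontier K)"

definition regular_curve :: "(real \<Rightarrow> real^2) \<Rightarrow> bool" where
  "regular_curve c \<longleftrightarrow> (\<forall>x. D 1 c x \<noteq> 0)"

definition rot90 :: "real^2 \<Rightarrow> real^2" where
  "rot90 v = vector [- v $ 2, v $ 1]"

definition unit_normal :: "(real \<Rightarrow> real^2) \<Rightarrow> real \<Rightarrow> real^2" where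
  "unit_normal c x = (1 / norm (D 1 c x)) *\<^sub>R rot90 (D 1 c x)"

text \<open>
  Signed curvature with respect to a unit normal \<open>\<nu>\<close>: the \<open>\<nu>\<close>-component of the
  curvature vector. It is positive iff the curve bends towards \<open>\<nu>\<close>, and it changes sign with
  \<open>\<nu>\<close>.
\<close>

definition signed_curvature :: "(real \<Rightarrow> real^2) \<Rightarrow> real^2 \<Rightarrow> real \<Rightarrow> real" where
  "signed_curvature c \<nu> x = (D 2 c x \<bullet> \<nu>) / (norm (D 1 c x))\<^sup>2"

definition nonzero_curvature :: "(real \<Rightarrow> real^2) \<Rightarrow> bool" where
  "nonzero_curvature c \<longleftrightarrow> (\<forall>x. signed_curvature c (unit_normal c x) x \<noteq> 0)"

text \<open>The center of curvature; it does not depend on which of the two unit normals is used.\<close>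

definition evolute :: "(real \<Rightarrow> real^2) \<Rightarrow> real \<Rightarrow> real^2" where
  "evolute c x =
     c x + (1 / signed_curvature c (unit_normal c x) x) *\<^sub>R unit_normal c x"

text \<open>A cusp of the evolute is a singular point, i.e. a point where its velocity vanishes.\<close>

definition evolute_cusp :: "(real \<Rightarrow> real^2) \<Rightarrow> real \<Rightarrow> bool" where
  "evolute_cusp c x \<longleftrightarrow> vector_derivative (evolute c) (at x) = 0"

text \<open>Parameters differing by a multiple of the period are the same parameter.\<close>

definition general_point :: "real \<Rightarrow> real \<Rightarrow> (real \<Rightarrow> real^2) \<Rightarrow> real \<Rightarrow> bool" where
  "general_point a b c x \<longleftrightarrow>
     \<not> evolute_cusp c x \<and>
     (\<forall>y. evolute c y = evolute c x \<longrightarrow> (\<exists>k::int. y = x + of_int k * (b - a)))"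


section \<open>Local convexity and sides\<close>

text \<open>Strict convexity: through every point passes a support line that meets the arc only there.\<close>

definition strictly_convex_curve :: "(real^2) set \<Rightarrow> bool" where
  "strictly_convex_curve A \<longleftrightarrow>
     A homeomorphic {0<..<1::real} \<and>
     (\<forall>p\<in>A. \<exists>\<nu>. \<forall>x\<in>A - {p}. \<nu> \<bullet> (x - p) > 0)"

definition locally_convex_at :: "(real^2) set \<Rightarrow> real^2 \<Rightarrow> bool" where
  "locally_convex_at \<Gamma> p \<longleftrightarrow>
     (\<exists>V. open V \<and> p \<in> V \<and> strictly_convex_curve (\<Gamma> \<inter> V))"

text \<open>
  \<open>\<Gamma>\<close> cuts \<open>V\<close> into exactly two regions, both bordering on it: the convex side \<open>A\<close> and the
  concave side \<open>B\<close>.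
\<close>

definition convex_concave_sides ::
  "(real^2) set \<Rightarrow> (real^2) set \<Rightarrow> (real^2) set \<Rightarrow> (real^2) set \<Rightarrow> bool" where
  "convex_concave_sides \<Gamma> V A B \<longleftrightarrow>
     strictly_convex_curve (\<Gamma> \<inter> V) \<and>
     components (V - \<Gamma>) = {A, B} \<and>
     \<Gamma> \<inter> V \<subseteq> frontier A \<and> \<Gamma> \<inter> V \<subseteq> frontier B \<and>
     convex A \<and> \<not> convex B"

text \<open>
  Since the curves \<open>\<Gamma> t\<close> move together with the point \<open>q t\<close>, the sides at time \<open>t\<close> are those of
  \<open>\<Gamma> t\<close>, all taken in one neighbourhood \<open>V\<close> of \<open>q s\<close>, for all \<open>t\<close> near \<open>s\<close>
  (including \<open>t = s\<close>). For a curve \<open>\<Gamma>\<close> that does not depend on \<open>t\<close> these are the sides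
  of \<open>\<Gamma> s\<close>.
\<close>

definition moves_convex_to_concave ::
  "(real \<Rightarrow> (real^2) set) \<Rightarrow> (real \<Rightarrow> real^2) \<Rightarrow> real \<Rightarrow> bool" where
  "moves_convex_to_concave \<Gamma> q s \<longleftrightarrow>
     (\<exists>V A B. open V \<and> q s \<in> V \<and>
        (\<forall>\<^sub>F t in nhds s. convex_concave_sides (\<Gamma> t) V (A t) (B t)) \<and>
        (\<forall>\<^sub>F t in at_left s. q t \<in> A t) \<and> (\<forall>\<^sub>F t in at_right s. q t \<in> B t))"

definition moves_concave_to_convex ::
  "(real \<Rightarrow> (real^2) set) \<Rightarrow> (real \<Rightarrow> real^2) \<Rightarrow> real \<Rightarrow> bool" where
  "moves_concave_to_convex \<Gamma> q s \<longleftrightarrow>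
     (\<exists>V A B. open V \<and> q s \<in> V \<and>
        (\<forall>\<^sub>F t in nhds s. convex_concave_sides (\<Gamma> t) V (A t) (B t)) \<and>
        (\<forall>\<^sub>F t in at_left s. q t \<in> B t) \<and> (\<forall>\<^sub>F t in at_right s. q t \<in> A t))"

text \<open>
  The path \<open>q\<close> is only continuous, so transversality is topological: \<open>q\<close> meets the curve and
  passes from one of its sides to the other.
\<close>

definition transversely_intersects ::
  "(real \<Rightarrow> (real^2) set) \<Rightarrow> (real \<Rightarrow> real^2) \<Rightarrow> real \<Rightarrow> bool" where
  "transversely_intersects \<Gamma> q s \<longleftrightarrow>
     q s \<in> \<Gamma> s \<and> (moves_convex_to_concave \<Gamma> q s \<or> moves_concave_to_convex \<Gamma> q s)"


section \<open>Equilibria and imaginary equilibrium indices\<close>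

text \<open>
  The distance function fails to be differentiable only where the curve passes through the
  reference point; such a point (a minimum of the distance) counts as critical.
\<close>

definition critical_point :: "(real \<Rightarrow> real) \<Rightarrow> real \<Rightarrow> bool" where
  "critical_point f x \<longleftrightarrow>
     \<not> f differentiable (at x) \<or> (f has_real_derivative 0) (at x)"

definition equilibrium_params ::
  "real \<Rightarrow> real \<Rightarrow> (real \<Rightarrow> real^2) \<Rightarrow> real^2 \<Rightarrow> real set" where
  "equilibrium_params a b c q = {x \<in> {a..<b}. critical_point (\<lambda>y. norm (c y - q)) x}"

definition equilibrium_points ::
  "real \<Rightarrow> real \<Rightarrow> (real \<Rightarrow> real^2) \<Rightarrow> real^2 \<Rightarrow> (real^2) set" where
  "equilibrium_points a b c q = c ` equilibrium_params a b c q"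

definition equilibrium_number ::
  "real \<Rightarrow> real \<Rightarrow> (real \<Rightarrow> real^2) \<Rightarrow> real^2 \<Rightarrow> nat" where
  "equilibrium_number a b c q = card (equilibrium_points a b c q)"

definition eq_rho :: "(real \<Rightarrow> real^2) \<Rightarrow> real^2 \<Rightarrow> real \<Rightarrow> real" where
  "eq_rho c q x = norm (c x - q)"

definition eq_kappa :: "(real \<Rightarrow> real^2) \<Rightarrow> real^2 \<Rightarrow> real \<Rightarrow> real" where
  "eq_kappa c q x = signed_curvature c ((1 / eq_rho c q x) *\<^sub>R (c x - q)) x"

definition nondegenerate :: "(real \<Rightarrow> real^2) \<Rightarrow> real^2 \<Rightarrow> real \<Rightarrow> bool" where
  "nondegenerate c q x \<longleftrightarrow> 1 + eq_kappa c q x * eq_rho c q x \<noteq> 0"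

definition S0 :: "(real \<Rightarrow> real^2) \<Rightarrow> real^2 \<Rightarrow> real \<Rightarrow> real" where
  "S0 c q x = 1 / \<bar>eq_kappa c q x * eq_rho c q x + 1\<bar>"

definition U0 :: "(real \<Rightarrow> real^2) \<Rightarrow> real^2 \<Rightarrow> real \<Rightarrow> real" where
  "U0 c q x = \<bar>eq_kappa c q x * eq_rho c q x\<bar> / \<bar>eq_kappa c q x * eq_rho c q x + 1\<bar>"

text \<open>
  The sum runs over the parameters of the equilibrium points; for a curve that is injective on
  \<open>{a..<b}\<close> these correspond one to one to the points.
\<close>

definition N0 :: "real \<Rightarrow> real \<Rightarrow> (real \<Rightarrow> real^2) \<Rightarrow> real^2 \<Rightarrow> real" where
  "N0 a b c q = (\<Sum>x\<in>equilibrium_params a b c q. S0 c q x + U0 c q x)"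

text \<open>The conditions under which the number of equilibria and \<open>N0\<close> are meaningful.\<close>

definition generic_equilibria ::
  "real \<Rightarrow> real \<Rightarrow> (real \<Rightarrow> real^2) \<Rightarrow> real^2 \<Rightarrow> bool" where
  "generic_equilibria a b c q \<longleftrightarrow>
     finite (equilibrium_points a b c q) \<and>
     (\<forall>x\<in>equilibrium_params a b c q. nondegenerate c q x)"

end

theory Submission
  imports Defs
begin

text \<open>
  Put \<open>F(t,p,x) = (r\<^sub>t(x) - p) \<bullet> r\<^sub>t'(x)\<close>, half the derivative of the squared distance from \<open>p\<close> to
  the curve at time \<open>t\<close>. Its zeros in \<open>x\<close> are the equilibria with respect to \<open>p\<close>; an equilibrium is degenerate iff
  \<open>F\<^sub>x\<close> vanishes too, and this happens iff \<open>p\<close> is the center of curvature \<open>E\<^sub>t(x)\<close>. The two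
  imaginary indices add up to \<open>(\<bar>r'\<bar>\<^sup>2 + \<bar>(r - p) \<bullet> r''\<bar>) / \<bar>F\<^sub>x\<bar>\<close>, which is continuous at simple
  zeros of \<open>F\<close> and infinite at double zeros.

  Differentiating \<open>F(t,E(x),x) = F\<^sub>x(t,E(x),x) = 0\<close> along the evolute shows that \<open>E' = 0\<close> wherever
  \<open>F\<^sub>x\<^sub>x = 0\<close>. Hence at a point that is not a cusp \<open>F\<close> has an ordinary fold: up to a sign
  \<open>\<sigma>\<close> it is strictly convex in \<open>x\<close> on an interval \<open>J\<close> around \<open>\<tau>0\<close> and positive at the ends of \<open>J\<close>, so
  there it has no zeros or exactly two, according to the sign of its minimum. The rest of the period is an
  interval \<open>K\<close> on which, by generality of the point, all zeros are simple. Simple zeros persist: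
  their number is constant near the critical time and their share of the index sum has a limit
  (\<open>zeros_K_stable\<close>). The two zeros in \<open>J\<close> are squeezed towards \<open>\<tau>0\<close>, where \<open>F\<^sub>x = 0\<close>, so their share
  of the index sum blows up (\<open>index_blow_up\<close>). Together this is \<open>equilibria_near_fold\<close>.

  It remains to identify the two regimes with the sides of the evolute (\<open>eventually_sides\<close>). Since \<open>F\<close> is affine in
  \<open>p\<close>, the points \<open>p\<close> with \<open>\<sigma> F > 0\<close> on all of \<open>J\<close> form an intersection of half-planes, a
  convex set \<open>P\<close>; near the critical point the set \<open>N\<close> of those with \<open>\<sigma> F < 0\<close> somewhere on \<open>J\<close> and \<open>P\<close>
  together make up the complement of the evolute. The midpoint of two distinct points of the arc over \<open>J\<close> lies in \<open>P\<close>. A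
  convex side has both points in its closure, hence meets \<open>P\<close>, contains \<open>P\<close>, and, being
  convex and disjoint from the evolute, cannot reach into \<open>N\<close>
  (\<open>convex_component_is_positive_side\<close>). So the convex side is \<open>P\<close>, without extra equilibria,
  and the concave side is \<open>N\<close>, with two extra ones.
\<close>

section \<open>Zeros of functions depending on a parameter\<close>

text \<open>
  All uniformity in the parameter comes from the tube lemma in this form. Disjunctions of open conditions
  enter it through a maximum: "wherever \<open>f\<close> vanishes, \<open>g > 0\<close>" becomes \<open>max \<bar>f\<bar> g > 0\<close>.
\<close>
lemma eventually_positive_on_compact:
  fixes g :: "'p::topological_space \<Rightarrow> 'x::topological_space \<Rightarrow> real"
  assumes "open I" "p0 \<in> I" "compact K"
    and cont: "continuous_on (I \<times> UNIV) (\<lambda>u. g (fst u) (snd u))"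
    and pos: "\<And>x. x \<in> K \<Longrightarrow> g p0 x > 0"
  shows "\<forall>\<^sub>F s in nhds p0. \<forall>x\<in>K. g s x > 0"
proof -
  define S where "S = (I \<times> UNIV) \<inter> (\<lambda>u. g (fst u) (snd u)) -` {0<..}"
  have "open S"
    unfolding S_def by (intro continuous_open_preimage cont open_Times assms) auto
  moreover have "{p0} \<times> K \<subseteq> S"
    using pos assms(2) by (auto simp: S_def)
  ultimately obtain X where "p0 \<in> X" "open X" "X \<times> K \<subseteq> S"
    using Elementary_Topology.tube_lemma[OF \<open>compact K\<close>, of S p0] by blast
  then show ?thesis
    unfolding eventually_nhds by (intro exI[of _ X]) (auto simp: S_def)
qed

lemma sections_of_continuous:
  assumes "continuous_on (I \<times> UNIV) (\<lambda>u. g (fst u) (snd u))" "s \<in> I"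
  shows "continuous_on S (g s)"
proof -
  have "continuous_on S (\<lambda>x. (\<lambda>u. g (fst u) (snd u)) (s, x))"
    by (rule continuous_on_compose2[OF assms(1)]) (use assms(2) in \<open>auto intro!: continuous_intros\<close>)
  then show ?thesis by simp
qed

text \<open>
  A form of the implicit function theorem over an arbitrary topological space of parameters: near a simple zero
  the function is strictly monotone with a sign change at the ends of a fixed interval, and both
  survive small changes of the parameter. The tube lemma on that interval makes the zero tend to \<open>z\<close>.
\<close>
lemma simple_zero_persists:
  fixes f f' :: "'p::topological_space \<Rightarrow> real \<Rightarrow> real"
  assumes I: "open I" "p0 \<in> I"
    and cont: "continuous_on (I \<times> UNIV) (\<lambda>u. f (fst u) (snd u))"
    and cont': "continuous_on (I \<times> UNIV) (\<lambda>u. f' (fst u) (snd u))"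
    and der: "\<And>s x. s \<in> I \<Longrightarrow> (f s has_real_derivative f' s x) (at x)"
    and zero: "f p0 z = 0" and simple: "f' p0 z \<noteq> 0"
  obtains d \<zeta> where "d > 0" "(\<zeta> \<longlongrightarrow> z) (nhds p0)"
    "\<forall>\<^sub>F s in nhds p0. \<forall>x\<in>{z-d..z+d}. f s x = 0 \<longleftrightarrow> x = \<zeta> s"
proof -
  define \<sigma> where "\<sigma> = sgn (f' p0 z)"
  have \<sigma>: "\<sigma> * f' p0 z > 0" "\<sigma> \<noteq> 0"
    using simple by (auto simp: \<sigma>_def sgn_if)
  have "isCont (\<lambda>x. \<sigma> * f' p0 x) z"
    using sections_of_continuous[OF cont' I(2), of UNIV]
    by (auto simp: continuous_on_eq_continuous_at intro!: continuous_intros)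
  then have "\<forall>\<^sub>F x in nhds z. \<sigma> * f' p0 x > 0"
    using tendsto_at_iff_tendsto_nhds[of "\<lambda>x. \<sigma> * f' p0 x" z] order_tendstoD(1)[OF _ \<sigma>(1)]
    by (simp add: isCont_def)
  then obtain d0 where d0: "d0 > 0" "\<And>x. dist x z < d0 \<Longrightarrow> \<sigma> * f' p0 x > 0"
    unfolding eventually_nhds_metric by blast
  define d where "d = d0 / 2"
  have d: "d > 0" "\<And>x. x \<in> {z-d..z+d} \<Longrightarrow> \<sigma> * f' p0 x > 0"
    using d0 by (auto simp: d_def dist_real_def)
  have incr: "\<sigma> * f s x < \<sigma> * f s y"
    if "s \<in> I" "\<forall>x\<in>{z-d..z+d}. \<sigma> * f' s x > 0" "x \<in> {z-d..z+d}" "y \<in> {z-d..z+d}" "x < y" for s x y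
  proof (rule DERIV_pos_imp_increasing[OF \<open>x < y\<close>])
    fix w assume "x \<le> w" "w \<le> y"
    then show "\<exists>l. DERIV (\<lambda>x. \<sigma> * f s x) w :> l \<and> 0 < l"
      using that der by (intro exI[of _ "\<sigma> * f' s w"]) (auto intro!: derivative_eq_intros)
  qed
  have ends: "\<sigma> * f p0 (z-d) < 0" "\<sigma> * f p0 (z+d) > 0"
    using incr[of p0 "z-d" z] incr[of p0 z "z+d"] I d zero by auto
  have ev1: "\<forall>\<^sub>F s in nhds p0. \<forall>x\<in>{z-d..z+d}. \<sigma> * f' s x > 0"
    by (rule eventually_positive_on_compact[OF I]) (auto intro!: continuous_intros cont' d)
  have ev2: "\<forall>\<^sub>F s in nhds p0. \<forall>x\<in>{z-d}. - \<sigma> * f s x > 0"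
    by (rule eventually_positive_on_compact[OF I]) (use ends in \<open>auto intro!: continuous_intros cont\<close>)
  have ev3: "\<forall>\<^sub>F s in nhds p0. \<forall>x\<in>{z+d}. \<sigma> * f s x > 0"
    by (rule eventually_positive_on_compact[OF I]) (use ends in \<open>auto intro!: continuous_intros cont\<close>)
  have ev4: "\<forall>\<^sub>F s in nhds p0. s \<in> I"
    using I by (auto simp: eventually_nhds)
  have ex: "\<exists>y. \<forall>x\<in>{z-d..z+d}. f s x = 0 \<longleftrightarrow> x = y"
    "\<exists>y\<in>{z-d..z+d}. f s y = 0"
    if s: "s \<in> I" "\<forall>x\<in>{z-d..z+d}. \<sigma> * f' s x > 0" "- \<sigma> * f s (z-d) > 0" "\<sigma> * f s (z+d) > 0" for s
  proof -
    have "\<exists>x\<ge>z-d. x \<le> z+d \<and> \<sigma> * f s x = 0"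
      by (rule IVT') (use s d in \<open>auto intro!: continuous_intros sections_of_continuous[OF cont]\<close>)
    then obtain y where y: "y \<in> {z-d..z+d}" "f s y = 0" using \<sigma> by auto
    show "\<exists>y\<in>{z-d..z+d}. f s y = 0" using y by blast
    show "\<exists>y. \<forall>x\<in>{z-d..z+d}. f s x = 0 \<longleftrightarrow> x = y"
    proof (intro exI[of _ y] ballI iffI)
      fix x assume x: "x \<in> {z-d..z+d}"
      show "x = y" if "f s x = 0"
        using incr[OF s(1,2) x y(1)] incr[OF s(1,2) y(1) x] that y(2) by (cases x y rule: linorder_cases) auto
    qed (use y in auto)
  qed
  define \<zeta> where "\<zeta> s = (SOME y. y \<in> {z-d..z+d} \<and> f s y = 0)" for s
  have ev5: "\<forall>\<^sub>F s in nhds p0. (\<zeta> s \<in> {z-d..z+d} \<and> f s (\<zeta> s) = 0) \<and> 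
      (\<forall>x\<in>{z-d..z+d}. f s x = 0 \<longleftrightarrow> x = \<zeta> s)"
    using ev1 ev2 ev3 ev4
  proof eventually_elim
    case (elim s)
    note e = ex[of s]
    have *: "\<zeta> s \<in> {z-d..z+d} \<and> f s (\<zeta> s) = 0"
      unfolding \<zeta>_def by (rule someI_ex) (use e(2) elim in auto)
    obtain y where y: "\<forall>x\<in>{z-d..z+d}. f s x = 0 \<longleftrightarrow> x = y"
      using e(1) elim by auto
    then have "y = \<zeta> s" using bspec[OF y, of "\<zeta> s"] * by simp
    then show ?case using y * by simp
  qed
  have "(\<zeta> \<longlongrightarrow> z) (nhds p0)"
  proof (rule tendstoI)
    fix e :: real assume "e > 0"
    have "\<forall>\<^sub>F s in nhds p0. \<forall>x\<in>{z-d..z+d}. max \<bar>f s x\<bar> (e - \<bar>x - z\<bar>) > 0"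
    proof (rule eventually_positive_on_compact[OF I])
      fix x assume x: "x \<in> {z-d..z+d}"
      show "max \<bar>f p0 x\<bar> (e - \<bar>x - z\<bar>) > 0"
      proof (cases "x = z")
        case False
        then have "f p0 x \<noteq> 0"
          using incr[of p0 x z] incr[of p0 z x] zero I d x by (cases x z rule: linorder_cases) auto
        then show ?thesis by auto
      qed (use \<open>e > 0\<close> in auto)
    qed (auto intro!: continuous_intros cont)
    with ev5 show "\<forall>\<^sub>F s in nhds p0. dist (\<zeta> s) z < e"
      by eventually_elim (force simp: dist_real_def)
  qed
  moreover have "\<forall>\<^sub>F s in nhds p0. \<forall>x\<in>{z-d..z+d}. f s x = 0 \<longleftrightarrow> x = \<zeta> s"
    using ev5 by eventually_elim blast
  ultimately show thesis using that d(1) by blast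
qed

lemma simple_zeros_finite:
  fixes f f' :: "real \<Rightarrow> real"
  assumes "compact K"
    and der: "\<And>x. (f has_real_derivative f' x) (at x)"
    and simple: "\<And>x. x \<in> K \<Longrightarrow> f x = 0 \<Longrightarrow> f' x \<noteq> 0"
  shows "finite {x\<in>K. f x = 0}"
proof -
  have "\<not> z islimpt {x. f x = 0}" if "z \<in> K" for z
  proof
    assume lim: "z islimpt {x. f x = 0}"
    have contf: "continuous_on UNIV f"
      using der DERIV_continuous_on has_field_derivative_at_within by blast
    have "closed {x. f x = 0}"
      using continuous_closed_preimage_constant[OF contf closed_UNIV, of 0] by simp
    then have fz: "f z = 0" using lim closed_limpt by blast
    have "((\<lambda>x. (f x - f z) / (x - z)) \<longlongrightarrow> f' z) (at z)"
      using der[of z] by (simp add: has_field_derivative_iff)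
    then have "\<forall>\<^sub>F x in at z. (f x - f z) / (x - z) \<noteq> 0"
      using simple[OF that fz] by (rule tendsto_imp_eventually_ne)
    then have "\<forall>\<^sub>F x in at z. f x \<noteq> 0"
      by eventually_elim (use fz in auto)
    moreover have "\<exists>\<^sub>F x in at z. f x = 0"
      using lim islimpt_conv_frequently_at[of z] by auto
    ultimately show False
      by (auto simp: frequently_def)
  qed
  then have "finite (K \<inter> {x. f x = 0})"
    by (intro finite_not_islimpt_in_compact assms)
  then show ?thesis by (simp add: Int_def)
qed

text \<open>
  Away from small intervals around its finitely many zeros the function is nonzero on a compact set, and so it stays
  nonzero there; hence near \<open>p0\<close> the zeros are exactly the continuations of the old ones. They are
  distinct because their limits are. The condition at the ends keeps zeros from leaving the interval.
\<close>
lemma simple_zeros_persist: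
  fixes f f' :: "'p::topological_space \<Rightarrow> real \<Rightarrow> real"
  assumes I: "open I" "p0 \<in> I"
    and cont: "continuous_on (I \<times> UNIV) (\<lambda>u. f (fst u) (snd u))"
    and cont': "continuous_on (I \<times> UNIV) (\<lambda>u. f' (fst u) (snd u))"
    and der: "\<And>s x. s \<in> I \<Longrightarrow> (f s has_real_derivative f' s x) (at x)"
    and simple: "\<And>x. x \<in> {u..v} \<Longrightarrow> f p0 x = 0 \<Longrightarrow> f' p0 x \<noteq> 0"
    and ends: "f p0 u \<noteq> 0" "f p0 v \<noteq> 0"
  defines "Z \<equiv> {x\<in>{u..v}. f p0 x = 0}"
  obtains \<zeta> where "finite Z" "\<And>z. z \<in> Z \<Longrightarrow> (\<zeta> z \<longlongrightarrow> z) (nhds p0)"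
    "\<forall>\<^sub>F s in nhds p0. bij_betw (\<lambda>z. \<zeta> z s) Z {x\<in>{u..v}. f s x = 0}"
proof -
  have fin: "finite Z"
    unfolding Z_def by (rule simple_zeros_finite) (use der I simple in auto)
  have "\<forall>z\<in>Z. \<exists>d \<zeta>. d > 0 \<and> (\<zeta> \<longlongrightarrow> z) (nhds p0) \<and>
    (\<forall>\<^sub>F s in nhds p0. \<forall>x\<in>{z-d..z+d}. f s x = 0 \<longleftrightarrow> x = \<zeta> s)"
  proof
    fix z assume "z \<in> Z"
    then have "f p0 z = 0" "f' p0 z \<noteq> 0" using simple by (auto simp: Z_def)
    from simple_zero_persists[OF I cont cont' der this]
    show "\<exists>d \<zeta>. d > 0 \<and> (\<zeta> \<longlongrightarrow> z) (nhds p0) \<and>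
      (\<forall>\<^sub>F s in nhds p0. \<forall>x\<in>{z-d..z+d}. f s x = 0 \<longleftrightarrow> x = \<zeta> s)" by blast
  qed
  then obtain d where "\<forall>z\<in>Z. \<exists>\<zeta>. d z > 0 \<and> (\<zeta> \<longlongrightarrow> z) (nhds p0) \<and>
    (\<forall>\<^sub>F s in nhds p0. \<forall>x\<in>{z-d z..z+d z}. f s x = 0 \<longleftrightarrow> x = \<zeta> s)"
    by (auto dest!: bchoice)
  then obtain \<zeta> where "\<forall>z\<in>Z. d z > 0 \<and> (\<zeta> z \<longlongrightarrow> z) (nhds p0) \<and>
    (\<forall>\<^sub>F s in nhds p0. \<forall>x\<in>{z-d z..z+d z}. f s x = 0 \<longleftrightarrow> x = \<zeta> z s)"
    by (drule_tac bchoice) blast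
  then have d: "\<And>z. z \<in> Z \<Longrightarrow> d z > 0"
    and lim: "\<And>z. z \<in> Z \<Longrightarrow> (\<zeta> z \<longlongrightarrow> z) (nhds p0)"
    and ev: "\<And>z. z \<in> Z \<Longrightarrow> 
      \<forall>\<^sub>F s in nhds p0. \<forall>x\<in>{z-d z..z+d z}. f s x = 0 \<longleftrightarrow> x = \<zeta> z s"
    by auto
  have ev1: "\<forall>\<^sub>F s in nhds p0. \<forall>z\<in>Z. \<forall>x\<in>{z-d z..z+d z}. f s x = 0 \<longleftrightarrow> x = \<zeta> z s"
    unfolding eventually_ball_finite_distrib[OF fin] using ev by blast
  have near: "\<forall>\<^sub>F s in nhds p0. \<zeta> z s \<in> {z - d z<..<z + d z} \<inter> {u<..<v}" if "z \<in> Z" for z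
  proof -
    have "z \<noteq> u" "z \<noteq> v" using that ends by (auto simp: Z_def)
    then have "z \<in> {z - d z<..<z + d z} \<inter> {u<..<v}" using that d[OF that] unfolding Z_def by force
    then show ?thesis
      by (intro topological_tendstoD[OF lim[OF that]]) auto
  qed
  have ev2: "\<forall>\<^sub>F s in nhds p0. \<forall>z\<in>Z. \<zeta> z s \<in> {z - d z<..<z + d z} \<inter> {u<..<v}"
    unfolding eventually_ball_finite_distrib[OF fin] using near by blast
  have ne: "\<forall>\<^sub>F s in nhds p0. \<zeta> z s \<noteq> \<zeta> y s" if "z \<in> Z" "y \<in> Z" "z \<noteq> y" for z y
  proof -
    have "((\<lambda>s. \<zeta> z s - \<zeta> y s) \<longlongrightarrow> z - y) (nhds p0)"
      using lim that by (intro tendsto_diff) auto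
    then have "\<forall>\<^sub>F s in nhds p0. \<zeta> z s - \<zeta> y s \<noteq> 0"
      by (rule tendsto_imp_eventually_ne) (use that in auto)
    then show ?thesis by eventually_elim auto
  qed
  have ev3: "\<forall>\<^sub>F s in nhds p0. \<forall>z\<in>Z. \<forall>y\<in>Z. z \<noteq> y \<longrightarrow> \<zeta> z s \<noteq> \<zeta> y s"
    unfolding eventually_ball_finite_distrib[OF fin]
  proof (intro ballI)
    fix z y assume "z \<in> Z" "y \<in> Z"
    then show "\<forall>\<^sub>F s in nhds p0. z \<noteq> y \<longrightarrow> \<zeta> z s \<noteq> \<zeta> y s"
      using ne[of z y] by (cases "z = y") auto
  qed
  have ev4: "\<forall>\<^sub>F s in nhds p0. \<forall>x\<in>{u..v} - (\<Union>z\<in>Z. {z - d z<..<z + d z}). \<bar>f s x\<bar> > 0"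
  proof (rule eventually_positive_on_compact[OF I])
    show "compact ({u..v} - (\<Union>z\<in>Z. {z - d z<..<z + d z}))"
      by (intro compact_diff) auto
    fix x assume x: "x \<in> {u..v} - (\<Union>z\<in>Z. {z - d z<..<z + d z})"
    have "x \<notin> Z"
    proof
      assume "x \<in> Z"
      moreover from this have "x \<in> {x - d x<..<x + d x}" using d by simp
      ultimately show False using x by blast
    qed
    then show "\<bar>f p0 x\<bar> > 0" using x by (auto simp: Z_def)
  qed (intro continuous_intros cont)
  have "\<forall>\<^sub>F s in nhds p0. bij_betw (\<lambda>z. \<zeta> z s) Z {x\<in>{u..v}. f s x = 0}"
    using ev1 ev2 ev3 ev4
  proof eventually_elim
    case (elim s)
    show ?case unfolding bij_betw_def
    proof (intro conjI equalityI subsetI)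
      show "inj_on (\<lambda>z. \<zeta> z s) Z" using elim(3) by (auto simp: inj_on_def)
    next
      fix x assume "x \<in> (\<lambda>z. \<zeta> z s) ` Z"
      then obtain z where z: "z \<in> Z" "x = \<zeta> z s" by blast
      have "x \<in> {z - d z<..<z + d z} \<inter> {u<..<v}" using elim(2) z by blast
      moreover from this have "f s x = 0" using elim(1) z by auto
      ultimately show "x \<in> {x\<in>{u..v}. f s x = 0}" by auto
    next
      fix x assume x: "x \<in> {x\<in>{u..v}. f s x = 0}"
      then obtain z where z: "z \<in> Z" "x \<in> {z - d z<..<z + d z}" using elim(4) by force
      then have "x = \<zeta> z s" using elim(1) x by auto
      then show "x \<in> (\<lambda>z. \<zeta> z s) ` Z" using z by blast
    qed
  qed
  then show thesis using that fin lim by blast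
qed

text \<open>
  The function lies above its tangent at \<open>z\<close>, which is the zero line. The mean value theorem is applied twice,
  because convexity is known on \<open>{u..v}\<close> only.
\<close>
lemma double_zero_positive:
  fixes g g' g'' :: "real \<Rightarrow> real"
  assumes der: "\<And>x. (g has_real_derivative g' x) (at x)" "\<And>x. (g' has_real_derivative g'' x) (at x)"
    and pos: "\<And>x. x \<in> {u..v} \<Longrightarrow> g'' x > 0"
    and z: "z \<in> {u..v}" "g z = 0" "g' z = 0" and x: "x \<in> {u..v}" "x \<noteq> z"
  shows "g x > 0"
proof (cases "x < z")
  case True
  obtain w where w: "x < w" "w < z" "g z - g x = (z - x) * g' w"
    using MVT2[OF True, of g g'] der by blast
  obtain y where y: "w < y" "y < z" "g' z - g' w = (z - w) * g'' y"
    using MVT2[OF w(2), of g' g''] der by blast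
  have "(z - w) * g'' y > 0" using y w z x pos[of y] by (intro mult_pos_pos) auto
  then have "g' w < 0" using y z by linarith
  then show ?thesis using w z mult_pos_neg[of "z - x" "g' w"] True by auto
next
  case False
  then have xz: "z < x" using x by auto
  obtain w where w: "z < w" "w < x" "g x - g z = (x - z) * g' w"
    using MVT2[OF xz, of g g'] der by blast
  obtain y where y: "z < y" "y < w" "g' w - g' z = (w - z) * g'' y"
    using MVT2[OF w(1), of g' g''] der by blast
  have "(w - z) * g'' y > 0" using y w z x pos[of y] by (intro mult_pos_pos) auto
  then have "g' w > 0" using y z by linarith
  then show ?thesis using w z mult_pos_pos[of "x - z" "g' w"] xz by auto
qed

lemma convex_function_two_zeros:
  fixes g g' g'' :: "real \<Rightarrow> real"
  assumes der: "\<And>x. (g has_real_derivative g' x) (at x)" "\<And>x. (g' has_real_derivative g'' x) (at x)"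
    and pos: "\<And>x. x \<in> {u..v} \<Longrightarrow> g'' x > 0"
    and ends: "g u > 0" "g v > 0" and neg: "w \<in> {u..v}" "g w < 0"
  shows "card {x\<in>{u..v}. g x = 0} = 2"
proof -
  have cont: "continuous_on S g" for S
    using der(1) DERIV_continuous_on has_field_derivative_at_within by blast
  have no3: False if "x < y" "y < z" "x \<in> {u..v}" "z \<in> {u..v}" "g x = 0" "g y = 0" "g z = 0" for x y z
  proof -
    obtain p where p: "x < p" "p < y" "g y - g x = (y - x) * g' p"
      using MVT2[OF \<open>x < y\<close>, of g g'] der by blast
    obtain q where q: "y < q" "q < z" "g z - g y = (z - y) * g' q"
      using MVT2[OF \<open>y < z\<close>, of g g'] der by blast
    have "p < q" using p q by simp
    obtain m where m: "p < m" "m < q" "g' q - g' p = (q - p) * g'' m"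
      using MVT2[OF \<open>p < q\<close>, of g' g''] der by blast
    show False using p q m that pos[of m] by auto
  qed
  have "\<exists>x\<ge>u. x \<le> w \<and> g x = 0"
    by (rule IVT2') (use ends neg cont in auto)
  then obtain x where x: "x \<in> {u..w}" "g x = 0" by auto
  have "\<exists>x\<ge>w. x \<le> v \<and> g x = 0"
    by (rule IVT') (use ends neg cont in auto)
  then obtain y where y: "y \<in> {w..v}" "g y = 0" by auto
  have xy: "x < y" using x y neg by (cases "x = w"; cases "y = w") auto
  have "{x\<in>{u..v}. g x = 0} = {x, y}"
  proof (intro equalityI subsetI)
    fix z assume z: "z \<in> {x\<in>{u..v}. g x = 0}"
    consider "z < x" | "z = x" | "x < z" "z < y" | "z = y" | "y < z" by linarith
    then show "z \<in> {x, y}"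
      by cases (use no3[of z x y] no3[of x z y] no3[of x y z] x y z xy neg in auto)
  qed (use x y neg in auto)
  then show ?thesis using xy by simp
qed

lemma translate_into_period:
  fixes x c T :: real
  assumes "T > 0"
  shows "x - of_int \<lfloor>(x - c) / T\<rfloor> * T \<in> {c..<c + T}"
  using floor_divide_lower[OF assms, of "x - c"] floor_divide_upper[OF assms, of "x - c"]
  by (auto simp: algebra_simps)

lemma periodic_int:
  fixes f :: "real \<Rightarrow> 'a" and T :: real
  assumes "\<And>x. f (x + T) = f x"
  shows "f (x + of_int k * T) = f x"
proof (induction k arbitrary: x rule: int_induct[where k = 0])
  case (step1 i)
  then show ?case using assms[of "x + of_int i * T"] by (simp add: algebra_simps)
next
  case (step2 i)
  then show ?case using assms[of "x + of_int (i - 1) * T"] by (simp add: algebra_simps)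
qed simp

text \<open>
  Equilibria are listed over a period starting at the given parameter \<open>a\<close>, which may itself be an equilibrium;
  this moves the cut to a parameter that is not one.
\<close>
lemma periodic_sum_shift:
  fixes Z :: "real set" and h :: "real \<Rightarrow> 'a::comm_monoid_add"
  assumes T: "T > 0" and Z: "\<And>x. x + T \<in> Z \<longleftrightarrow> x \<in> Z" and h: "\<And>x. h (x + T) = h x"
  shows "(\<Sum>x\<in>Z \<inter> {u..<u + T}. h x) = (\<Sum>x\<in>Z \<inter> {v..<v + T}. h x)"
proof -
  define \<phi> where "\<phi> c x = x - of_int \<lfloor>(x - c) / T\<rfloor> * T" for c x :: real
  have \<phi>: "\<phi> c x \<in> {c..<c + T}" for c x
    unfolding \<phi>_def by (rule translate_into_period[OF T])
  have per: "\<phi> c x \<in> Z \<longleftrightarrow> x \<in> Z" "h (\<phi> c x) = h x" for c x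
    using periodic_int[of "\<lambda>x. x \<in> Z" T x "- \<lfloor>(x - c) / T\<rfloor>"] Z
      periodic_int[of h T x "- \<lfloor>(x - c) / T\<rfloor>"] h by (auto simp: \<phi>_def)
  have inv: "\<phi> c (\<phi> e x) = x" if "x \<in> {c..<c + T}" for c e x
  proof -
    obtain k :: int where k: "\<phi> c (\<phi> e x) = x + of_int k * T"
      by (auto simp: \<phi>_def algebra_simps intro: that[of "- \<lfloor>(x - e) / T\<rfloor> - \<lfloor>(\<phi> e x - c) / T\<rfloor>"])
    have "x + of_int k * T \<in> {c..<c + T}" using \<phi>[of c "\<phi> e x"] k by simp
    with that have "of_int k * T < 1 * T" "(-1) * T < of_int k * T" by (simp_all only: atLeastLessThan_iff) linarith+
    then have "real_of_int k < 1" "-1 < real_of_int k"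
      using T mult_less_cancel_right_pos by blast+
    then have "k = 0" by linarith
    with k show ?thesis by simp
  qed
  show ?thesis
    by (rule sum.reindex_bij_witness[of _ "\<phi> u" "\<phi> v"]) (use \<phi> per inv in auto)
qed

section \<open>Which component is the convex one\<close>

text \<open>
  The set \<open>P\<close> will be the points near the crossing without tangent to the arc \<open>\<Gamma>\<close>, and \<open>N\<close> those
  with tangents. The two points \<open>e1\<close>, \<open>e2\<close> exclude that \<open>A\<close> lies on the side \<open>N\<close>: the
  closure of \<open>A\<close> is convex and contains them, hence also their midpoint, so \<open>A\<close> meets the open set \<open>P\<close>.
\<close>
lemma convex_component_is_positive_side:
  fixes \<Gamma> V W A B P N :: "('a::real_normed_vector) set"
  assumes comp: "components (V - \<Gamma>) = {A, B}" "A \<noteq> B"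
    and front: "\<Gamma> \<inter> V \<subseteq> frontier A"
    and A: "convex A" and W: "convex W" "W \<subseteq> V"
    and P: "open P" "convex P" and N: "open N" "P \<inter> N = {}" "W - \<Gamma> = P \<union> N"
    and e: "e1 \<in> \<Gamma> \<inter> W" "e2 \<in> \<Gamma> \<inter> W" "midpoint e1 e2 \<in> P"
  shows "A \<inter> W \<subseteq> P" "B \<inter> W \<subseteq> N"
proof -
  have AB: "A \<inter> B = {}" "A \<in> components (V - \<Gamma>)" "A \<subseteq> V - \<Gamma>" "B \<subseteq> V - \<Gamma>"
    using comp components_nonoverlap[of A "V - \<Gamma>" B] in_components_subset[of _ "V - \<Gamma>"] by auto
  have cl: "e1 \<in> closure A" "e2 \<in> closure A"
    using e front W by (auto simp: frontier_def)
  have "midpoint e1 e2 \<in> closure A"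
    using convexD[OF convex_closure[OF A] cl, of "1/2" "1/2"]
    by (simp add: midpoint_def scaleR_add_right inverse_eq_divide)
  with e(3) P(1) have meet: "A \<inter> P \<noteq> {}"
    by (metis disjoint_iff open_Int_closure_eq_empty inf_commute)
  have "P \<subseteq> V - \<Gamma>" using N W by auto
  then have PA: "P \<subseteq> A"
    using components_maximal[OF AB(2) convex_connected[OF P(2)]] meet by blast
  have "connected (A \<inter> W)"
    using A W by (intro convex_connected convex_Int)
  moreover have "A \<inter> W \<subseteq> P \<union> N" using AB N by blast
  moreover have "P \<inter> (A \<inter> W) \<noteq> {}" using meet N W by auto
  ultimately have "N \<inter> (A \<inter> W) = {}"
    using P(1) N(1,2) unfolding connected_def by blast
  then show "A \<inter> W \<subseteq> P" using AB N by blast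
  show "B \<inter> W \<subseteq> N" using AB N PA by blast
qed

section \<open>Equilibria and the evolute of a single oval\<close>

text \<open>
  The derivatives of order one to three of half the squared distance to \<open>p\<close>.
\<close>
definition sqd1 :: "(real \<Rightarrow> real^2) \<Rightarrow> real^2 \<Rightarrow> real \<Rightarrow> real" where
  "sqd1 c p x = (c x - p) \<bullet> D 1 c x"

definition sqd2 :: "(real \<Rightarrow> real^2) \<Rightarrow> real^2 \<Rightarrow> real \<Rightarrow> real" where
  "sqd2 c p x = D 1 c x \<bullet> D 1 c x + (c x - p) \<bullet> D 2 c x"

definition sqd3 :: "(real \<Rightarrow> real^2) \<Rightarrow> real^2 \<Rightarrow> real \<Rightarrow> real" where
  "sqd3 c p x = 3 * (D 1 c x \<bullet> D 2 c x) + (c x - p) \<bullet> D 3 c x"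

text \<open>
  The value of \<open>S0 + U0\<close> at an equilibrium, see \<open>indices_sum\<close>; unlike those it needs no division
  by the distance.
\<close>
definition index_sum :: "(real \<Rightarrow> real^2) \<Rightarrow> real^2 \<Rightarrow> real \<Rightarrow> real" where
  "index_sum c p x = (D 1 c x \<bullet> D 1 c x + \<bar>(c x - p) \<bullet> D 2 c x\<bar>) / \<bar>sqd2 c p x\<bar>"

lemma D_0 [simp]: "D 0 c = c"
  by (simp add: D_def)

lemma D_Suc: "D (Suc k) c = (\<lambda>x. vector_derivative (D k c) (at x))"
  by (simp add: D_def)

(* For this section only: keeps D 1 from being rewritten to D (Suc 0). *)
declare One_nat_def [simp del]

lemma has_real_derivative_inner [derivative_intros]:
  fixes f g :: "real \<Rightarrow> 'a::real_inner"
  assumes "(f has_vector_derivative f') (at x)" "(g has_vector_derivative g') (at x)"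
  shows "((\<lambda>x. f x \<bullet> g x) has_real_derivative (f x \<bullet> g' + f' \<bullet> g x)) (at x)"
  using bounded_bilinear.has_vector_derivative[OF bounded_bilinear_inner assms]
  by (simp add: has_real_derivative_iff_has_vector_derivative)

lemma rot90_nth [simp]: "rot90 v $ 1 = - v $ 2" "rot90 v $ 2 = v $ 1"
  by (simp_all add: rot90_def)

lemma inner_2: "(u::real^2) \<bullet> v = u $ 1 * v $ 1 + u $ 2 * v $ 2"
  by (simp add: inner_vec_def sum_2)

lemma linear_rot90: "linear rot90"
  by (rule linearI) (auto simp: vec_eq_iff forall_2)

lemma bounded_linear_rot90: "bounded_linear rot90"
  using linear_rot90 by (simp add: linear_conv_bounded_linear)

lemma rot90_inner_self [simp]: "rot90 v \<bullet> v = 0" "v \<bullet> rot90 v = 0"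
  by (auto simp: inner_2)

lemma eq_0_if_orthogonal_to_basis:
  fixes u v w :: "real^2"
  assumes "w \<bullet> rot90 u \<noteq> 0" "v \<bullet> u = 0" "v \<bullet> w = 0"
  shows "v = 0"
proof -
  have "v $ 1 * (w \<bullet> rot90 u) = (v \<bullet> u) * w $ 2 - (v \<bullet> w) * u $ 2"
    "v $ 2 * (w \<bullet> rot90 u) = (v \<bullet> w) * u $ 1 - (v \<bullet> u) * w $ 1"
    by (auto simp: inner_2 algebra_simps)
  then have "v $ 1 = 0" "v $ 2 = 0" using assms by auto
  then show ?thesis by (auto simp: vec_eq_iff forall_2)
qed

locale oval =
  fixes a b :: real and c :: "real \<Rightarrow> real^2"
  assumes ab: "a < b" and C3: "C3_curve c" and regular: "regular_curve c"
    and closed_convex: "closed_convex_curve a b c" and curved: "nonzero_curvature c"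
begin

lemma has_D:
  assumes "k < 3"
  shows "(D k c has_vector_derivative D (Suc k) c x) (at x)"
  using C3 assms by (auto simp: C3_curve_def D_Suc vector_derivative_works[symmetric])

lemma has_D0: "(c has_vector_derivative D 1 c x) (at x)"
  and has_D1: "(D 1 c has_vector_derivative D 2 c x) (at x)"
  and has_D2: "(D 2 c has_vector_derivative D 3 c x) (at x)"
  using has_D[of 0 x] has_D[of 1 x] has_D[of 2 x] by (simp_all add: numeral_eq_Suc One_nat_def)

lemma D1_nz [simp]: "D 1 c x \<noteq> 0"
  using regular by (simp add: regular_curve_def)

lemma D1_pos: "D 1 c x \<bullet> D 1 c x > 0"
  by simp

lemma D2_rot90: "D 2 c x \<bullet> rot90 (D 1 c x) \<noteq> 0"
  using curved by (auto simp: nonzero_curvature_def signed_curvature_def unit_normal_def)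

lemma periodic: "c (x + (b - a)) = c x"
  using closed_convex by (simp add: closed_convex_curve_def)

lemma D_periodic: "k \<le> 3 \<Longrightarrow> D k c (x + (b - a)) = D k c x"
proof (induction k arbitrary: x)
  case (Suc k)
  have "((\<lambda>y. y + (b - a)) has_vector_derivative 1) (at x)"
    by (auto intro!: derivative_eq_intros)
  from vector_diff_chain_at[OF this has_D[of k "x + (b - a)"]]
  have "(D k c has_vector_derivative D (Suc k) c (x + (b - a))) (at x)"
    using Suc by (simp add: o_def)
  with has_D[of k x] Suc show ?case
    by (metis Suc_le_lessD vector_derivative_at)
qed (simp add: periodic)

lemma sqd_periodic:
  "sqd1 c p (x + (b - a)) = sqd1 c p x" "sqd2 c p (x + (b - a)) = sqd2 c p x"
  "index_sum c p (x + (b - a)) = index_sum c p x"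
  by (simp_all add: sqd1_def sqd2_def index_sum_def periodic D_periodic)

lemma sqd1_deriv: "(sqd1 c p has_real_derivative sqd2 c p x) (at x)"
  unfolding sqd1_def sqd2_def
  using has_D0[of x] has_D1[of x]
  by (auto intro!: derivative_eq_intros simp: inner_commute algebra_simps)

lemma sqd2_deriv: "(sqd2 c p has_real_derivative sqd3 c p x) (at x)"
  unfolding sqd2_def sqd3_def
  using has_D0[of x] has_D1[of x] has_D2[of x]
  by (auto intro!: derivative_eq_intros simp: inner_commute algebra_simps)

lemma evolute_formula:
  "evolute c x = c x + ((D 1 c x \<bullet> D 1 c x) / (D 2 c x \<bullet> rot90 (D 1 c x))) *\<^sub>R rot90 (D 1 c x)"
  by (simp add: evolute_def signed_curvature_def unit_normal_def power2_norm_eq_inner)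

text \<open>
  Both equations say that \<open>c x - p\<close> has prescribed components along \<open>D 1 c x\<close> and \<open>D 2 c x\<close>, which
  are linearly independent by nonzero curvature, so they determine \<open>p\<close>.
\<close>
lemma evolute_iff: "p = evolute c x \<longleftrightarrow> sqd1 c p x = 0 \<and> sqd2 c p x = 0"
proof -
  have E: "sqd1 c (evolute c x) x = 0" "sqd2 c (evolute c x) x = 0"
    using D2_rot90[of x]
    by (simp_all add: sqd1_def sqd2_def evolute_formula inner_commute)
  show ?thesis
  proof
    assume p: "sqd1 c p x = 0 \<and> sqd2 c p x = 0"
    have "(evolute c x - p) \<bullet> D 1 c x = 0" "(evolute c x - p) \<bullet> D 2 c x = 0"
      using E p by (simp_all add: sqd1_def sqd2_def inner_diff_left)
    from eq_0_if_orthogonal_to_basis[OF D2_rot90 this] show "p = evolute c x" by simp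
  qed (use E in auto)
qed

lemma evolute_differentiable: "evolute c differentiable at x"
proof -
  have [derivative_intros]: "c differentiable at x" "D 1 c differentiable at x" "D 2 c differentiable at x"
    using has_D0 has_D1 has_D2 differentiableI_vector by blast+
  have [derivative_intros]: "(\<lambda>x. rot90 (D 1 c x)) differentiable at x"
    using has_D1[of x] bounded_linear.has_vector_derivative[OF bounded_linear_rot90] differentiableI_vector by blast
  show ?thesis
    unfolding evolute_formula[abs_def]
    by (intro differentiable_add differentiable_scaleR differentiable_divide differentiable_inner derivative_intros D2_rot90)
qed

text \<open>
  Differentiating the two equations of \<open>evolute_iff\<close> along the evolute shows that its velocity is
  orthogonal to \<open>D 1 c x\<close> and has inner product \<open>sqd3\<close> with \<open>D 2 c x\<close>.
\<close>
lemma cusp_if_sqd3_0: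
  assumes "sqd3 c (evolute c x) x = 0"
  shows "evolute_cusp c x"
proof -
  define E' where "E' = vector_derivative (evolute c) (at x)"
  have E': "(evolute c has_vector_derivative E') (at x)"
    using evolute_differentiable[of x] by (simp add: E'_def vector_derivative_works)
  have zero: "sqd1 c (evolute c y) y = 0" "sqd2 c (evolute c y) y = 0" for y
    using evolute_iff by auto
  have "((\<lambda>y. sqd1 c (evolute c y) y) has_real_derivative sqd2 c (evolute c x) x - E' \<bullet> D 1 c x) (at x)"
    unfolding sqd1_def sqd2_def
    using has_D0[of x] has_D1[of x] E'
    by (auto intro!: derivative_eq_intros simp: inner_commute algebra_simps)
  moreover have "((\<lambda>y. sqd1 c (evolute c y) y) has_real_derivative 0) (at x)"
    using zero by simp
  ultimately have 1: "E' \<bullet> D 1 c x = 0"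
    using DERIV_unique zero(2) by fastforce
  have "((\<lambda>y. sqd2 c (evolute c y) y) has_real_derivative sqd3 c (evolute c x) x - E' \<bullet> D 2 c x) (at x)"
    unfolding sqd2_def sqd3_def
    using has_D0[of x] has_D1[of x] has_D2[of x] E'
    by (auto intro!: derivative_eq_intros simp: inner_commute algebra_simps)
  moreover have "((\<lambda>y. sqd2 c (evolute c y) y) has_real_derivative 0) (at x)"
    using zero by simp
  ultimately have 2: "E' \<bullet> D 2 c x = 0"
    using DERIV_unique assms by fastforce
  have "E' = 0" using eq_0_if_orthogonal_to_basis[OF D2_rot90 1 2] .
  then show ?thesis by (simp add: evolute_cusp_def E'_def)
qed

text \<open>
  If \<open>p\<close> lies on the curve at \<open>x\<close>, the distance is either not differentiable there or has derivative zero
  because it is minimal; in both cases the point is critical, in accordance with \<open>sqd1 c p x = 0\<close>.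
\<close>
lemma critical_point_iff: "critical_point (\<lambda>y. norm (c y - p)) x \<longleftrightarrow> sqd1 c p x = 0"
proof (cases "c x = p")
  case True
  have "(f' = 0)" if "((\<lambda>y. norm (c y - p)) has_real_derivative f') (at x)" for f'
    using DERIV_local_min[OF that, of 1] True by auto
  then have "critical_point (\<lambda>y. norm (c y - p)) x"
    unfolding critical_point_def real_differentiable_def by metis
  then show ?thesis using True by (simp add: sqd1_def)
next
  case False
  have "((\<lambda>y. c y - p) has_derivative (\<lambda>h. h *\<^sub>R D 1 c x)) (at x)"
    using has_D0[of x] unfolding has_vector_derivative_def
    by (auto intro!: derivative_eq_intros)
  then have "((\<lambda>y. norm (c y - p)) has_derivative (\<lambda>h. (h *\<^sub>R D 1 c x) \<bullet> sgn (c x - p))) (at x)"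
    by (rule has_derivative_compose) (use False has_derivative_norm[of "c x - p"] in simp)
  then have "((\<lambda>y. norm (c y - p)) has_real_derivative (sqd1 c p x / norm (c x - p))) (at x)"
    unfolding has_field_derivative_def
    by (rule has_derivative_eq_rhs) (auto simp: sgn_div_norm sqd1_def inner_commute divide_inverse mult_ac)
  then show ?thesis
    using False DERIV_unique unfolding critical_point_def real_differentiable_def by fastforce
qed

lemma equilibrium_params_eq: "equilibrium_params a b c p = {x. sqd1 c p x = 0} \<inter> {a..<b}"
  by (auto simp: equilibrium_params_def critical_point_iff)

text \<open>
  If \<open>p\<close> lies on the curve, both sides are zero, so this case is no exception in what follows.
\<close>
lemma kappa_rho: "eq_kappa c p x * eq_rho c p x = (c x - p) \<bullet> D 2 c x / (D 1 c x \<bullet> D 1 c x)"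
  by (cases "c x = p")
    (auto simp: eq_kappa_def eq_rho_def signed_curvature_def power2_norm_eq_inner inner_commute)

lemma kappa_rho_1: "eq_kappa c p x * eq_rho c p x + 1 = sqd2 c p x / (D 1 c x \<bullet> D 1 c x)"
  by (simp add: kappa_rho sqd2_def add_divide_distrib)

lemma nondegenerate_iff: "nondegenerate c p x \<longleftrightarrow> sqd2 c p x \<noteq> 0"
  using kappa_rho_1[of p x] by (auto simp: nondegenerate_def add.commute)

lemma indices_sum: "S0 c p x + U0 c p x = index_sum c p x"
proof -
  have "S0 c p x + U0 c p x = (1 + \<bar>(c x - p) \<bullet> D 2 c x\<bar> / (D 1 c x \<bullet> D 1 c x)) / (\<bar>sqd2 c p x\<bar> / (D 1 c x \<bullet> D 1 c x))"
    unfolding S0_def U0_def kappa_rho_1 unfolding kappa_rho by (simp add: add_divide_distrib distrib_right)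
  also have "\<dots> = index_sum c p x"
  proof -
    have "(1 + g / d) / (m / d) = (d + g) / m" if "d \<noteq> 0" for d g m :: real
      using that by (cases "m = 0") (auto simp: field_simps)
    then show ?thesis unfolding index_sum_def by simp
  qed
  finally show ?thesis .
qed

lemma equilibrium_sums:
  shows "card (equilibrium_params a b c p) = card ({x. sqd1 c p x = 0} \<inter> {u..<u + (b - a)})"
    and "N0 a b c p = (\<Sum>x\<in>{x. sqd1 c p x = 0} \<inter> {u..<u + (b - a)}. index_sum c p x)"
    and "equilibrium_number a b c p = card (equilibrium_params a b c p)"
    and "finite (equilibrium_points a b c p) \<longleftrightarrow> finite (equilibrium_params a b c p)"
proof -
  have inj: "inj_on c (equilibrium_params a b c p)"
    using closed_convex unfolding closed_convex_curve_def equilibrium_params_def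
    by (auto intro: inj_on_subset)
  show "equilibrium_number a b c p = card (equilibrium_params a b c p)"
    "finite (equilibrium_points a b c p) \<longleftrightarrow> finite (equilibrium_params a b c p)"
    using inj by (simp_all add: equilibrium_number_def equilibrium_points_def card_image finite_image_iff)
  show "card (equilibrium_params a b c p) = card ({x. sqd1 c p x = 0} \<inter> {u..<u + (b - a)})"
    using periodic_sum_shift[of "b - a" "{x. sqd1 c p x = 0}" "\<lambda>_. 1::nat" a u] ab
    by (simp add: equilibrium_params_eq sqd_periodic)
  show "N0 a b c p = (\<Sum>x\<in>{x. sqd1 c p x = 0} \<inter> {u..<u + (b - a)}. index_sum c p x)"
    using periodic_sum_shift[of "b - a" "{x. sqd1 c p x = 0}" "index_sum c p" a u] ab
    by (simp add: equilibrium_params_eq sqd_periodic N0_def indices_sum)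
qed

lemma generic_if_off_evolute:
  assumes "p \<notin> range (evolute c)"
  shows "generic_equilibria a b c p"
proof -
  have simple: "sqd2 c p x \<noteq> 0" if "sqd1 c p x = 0" for x
    using that assms evolute_iff by blast
  have "finite {x\<in>{a..b}. sqd1 c p x = 0}"
    by (rule simple_zeros_finite[OF _ sqd1_deriv]) (use simple in auto)
  then have "finite (equilibrium_params a b c p)"
    by (rule rev_finite_subset) (auto simp: equilibrium_params_eq)
  then show ?thesis
    unfolding generic_equilibria_def equilibrium_sums(4) nondegenerate_iff
    using simple by (auto simp: equilibrium_params_eq)
qed

lemma range_evolute_iff: "p \<in> range (evolute c) \<longleftrightarrow> (\<exists>x\<in>{u..<u + (b - a)}. sqd1 c p x = 0 \<and> sqd2 c p x = 0)"
proof
  assume "p \<in> range (evolute c)"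
  then obtain x where x: "sqd1 c p x = 0" "sqd2 c p x = 0" using evolute_iff by auto
  define y where "y = x - of_int \<lfloor>(x - u) / (b - a)\<rfloor> * (b - a)"
  have "y \<in> {u..<u + (b - a)}"
    unfolding y_def by (rule translate_into_period) (use ab in simp)
  moreover have "sqd1 c p y = 0" "sqd2 c p y = 0"
    using x periodic_int[of "sqd1 c p" "b - a" x "- \<lfloor>(x - u) / (b - a)\<rfloor>"]
      periodic_int[of "sqd2 c p" "b - a" x "- \<lfloor>(x - u) / (b - a)\<rfloor>"] sqd_periodic
    by (simp_all add: y_def)
  ultimately show "\<exists>x\<in>{u..<u + (b - a)}. sqd1 c p x = 0 \<and> sqd2 c p x = 0" by blast
qed (use evolute_iff in auto)

end

declare One_nat_def [simp]

section \<open>Continuous families of ovals\<close>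

locale oval_family =
  fixes a b t0 t1 :: real and r :: "real \<Rightarrow> real \<Rightarrow> real^2"
  assumes ovals: "\<And>t. t \<in> {t0..t1} \<Longrightarrow> oval a b (r t)"
    and family: "\<And>k. k \<le> 3 \<Longrightarrow> continuous_on ({t0..t1} \<times> UNIV) (\<lambda>(t, x). D k (r t) x)"
begin

lemma continuous_on_D:
  assumes "k \<le> 3" "continuous_on S \<tau>" "continuous_on S \<xi>" "\<And>u. u \<in> S \<Longrightarrow> \<tau> u \<in> {t0..t1}"
  shows "continuous_on S (\<lambda>u. D k (r (\<tau> u)) (\<xi> u))"
proof -
  have "continuous_on S (\<lambda>u. (\<lambda>(t, x). D k (r t) x) (\<tau> u, \<xi> u))"
    by (rule continuous_on_compose2[OF family[OF assms(1)]])
      (use assms in \<open>auto intro!: continuous_intros\<close>)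
  then show ?thesis by simp
qed

lemma continuous_on_sqd:
  assumes "continuous_on S \<tau>" "continuous_on S p" "continuous_on S \<xi>" "\<And>u. u \<in> S \<Longrightarrow> \<tau> u \<in> {t0..t1}"
  shows "continuous_on S (\<lambda>u. sqd1 (r (\<tau> u)) (p u) (\<xi> u))"
    "continuous_on S (\<lambda>u. sqd2 (r (\<tau> u)) (p u) (\<xi> u))"
    "continuous_on S (\<lambda>u. sqd3 (r (\<tau> u)) (p u) (\<xi> u))"
proof -
  note D = continuous_on_D[OF _ assms(1,3,4)]
  have "continuous_on S (\<lambda>u. r (\<tau> u) (\<xi> u))" using D[of 0] by simp
  then show "continuous_on S (\<lambda>u. sqd1 (r (\<tau> u)) (p u) (\<xi> u))"
    "continuous_on S (\<lambda>u. sqd2 (r (\<tau> u)) (p u) (\<xi> u))"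
    "continuous_on S (\<lambda>u. sqd3 (r (\<tau> u)) (p u) (\<xi> u))"
    unfolding sqd1_def sqd2_def sqd3_def
    by (intro continuous_intros assms D; simp)+
qed

lemma continuous_on_evolute:
  assumes "continuous_on S \<tau>" "continuous_on S \<xi>" "\<And>u. u \<in> S \<Longrightarrow> \<tau> u \<in> {t0..t1}"
  shows "continuous_on S (\<lambda>u. evolute (r (\<tau> u)) (\<xi> u))"
proof -
  note D = continuous_on_D[OF _ assms]
  have r: "continuous_on S (\<lambda>u. r (\<tau> u) (\<xi> u))" using D[of 0] by simp
  have rot: "continuous_on S (\<lambda>u. rot90 (D 1 (r (\<tau> u)) (\<xi> u)))"
    using D[of 1] bounded_linear.continuous_on[OF bounded_linear_rot90] by auto
  have "continuous_on S (\<lambda>u. r (\<tau> u) (\<xi> u) + ((D 1 (r (\<tau> u)) (\<xi> u) \<bullet> D 1 (r (\<tau> u)) (\<xi> u)) /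
      (D 2 (r (\<tau> u)) (\<xi> u) \<bullet> rot90 (D 1 (r (\<tau> u)) (\<xi> u)))) *\<^sub>R rot90 (D 1 (r (\<tau> u)) (\<xi> u)))"
    using oval.D2_rot90[OF ovals] assms(3)
    by (intro continuous_intros r rot D) auto
  then show ?thesis
    by (rule continuous_on_eq) (rule oval.evolute_formula[OF ovals, symmetric], rule assms(3))
qed

end

section \<open>The fold at a general point of the evolute\<close>

text \<open>
  The half-width \<open>e\<close> and the sign \<open>\<sigma>\<close> are parameters chosen in the final proof: on the interval of
  half-width \<open>e\<close> around \<open>\<tau>0\<close> the function \<open>\<sigma> * sqd1\<close> is strictly convex at the critical
  time. The condition \<open>2 * e < b - a\<close> leaves room in the period for the complementary interval \<open>K\<close>.
\<close>
locale evolute_fold = oval_family a b t0 t1 r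
  for a b t0 t1 :: real and r :: "real \<Rightarrow> real \<Rightarrow> real^2" +
  fixes ts \<tau>0 :: real and q :: "real \<Rightarrow> real^2" and e \<sigma> :: real
  assumes path: "continuous_on {t0..t1} q"
    and ts: "ts \<in> {t0<..<t1}"
    and meet: "q ts = evolute (r ts) \<tau>0"
    and once: "\<And>y. evolute (r ts) y = evolute (r ts) \<tau>0 \<Longrightarrow> \<exists>k::int. y = \<tau>0 + of_int k * (b - a)"
    and e: "0 < e" "2 * e < b - a"
    and fold: "\<And>x. x \<in> {\<tau>0-e..\<tau>0+e} \<Longrightarrow> \<sigma> * sqd3 (r ts) (q ts) x > 0"
begin

abbreviation "J \<equiv> {\<tau>0-e..\<tau>0+e}"
abbreviation "K \<equiv> {\<tau>0+e..\<tau>0+(b-a)-e}"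
abbreviation "I \<equiv> {t0<..<t1}"

text \<open>
  The open conditions, true at \<open>(ts, q ts)\<close>, from which the picture near the fold is read off at all nearby
  times and points.
\<close>
definition near_fold :: "real \<Rightarrow> real^2 \<Rightarrow> bool" where
  "near_fold t p \<longleftrightarrow> t \<in> I \<and> (\<forall>x\<in>J. \<sigma> * sqd3 (r t) p x > 0) \<and>
     \<sigma> * sqd1 (r t) p (\<tau>0-e) > 0 \<and> \<sigma> * sqd1 (r t) p (\<tau>0+e) > 0 \<and>
     (\<forall>x\<in>K. sqd1 (r t) p x \<noteq> 0 \<or> sqd2 (r t) p x \<noteq> 0)"

text \<open>
  As \<open>sqd1 (r t) p x\<close> is affine in \<open>p\<close> and vanishes on the normal of the curve at \<open>x\<close>, this is an
  intersection of half-planes bounded by the normals with foot in \<open>J\<close>, which are the tangents of the arc of the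
  evolute over \<open>J\<close>.
\<close>
definition inner_side :: "real \<Rightarrow> (real^2) set" where
  "inner_side t = {p. \<forall>x\<in>J. \<sigma> * sqd1 (r t) p x > 0}"

definition outer_side :: "real \<Rightarrow> (real^2) set" where
  "outer_side t = {p. \<exists>x\<in>J. \<sigma> * sqd1 (r t) p x < 0}"

lemma oval_at: "t \<in> I \<Longrightarrow> oval a b (r t)"
  using ovals by auto

lemma \<sigma>_nz: "\<sigma> \<noteq> 0"
  using fold[of \<tau>0] e by auto

lemma scaled_derivs:
  assumes "t \<in> I"
  shows "((\<lambda>x. \<sigma> * sqd1 (r t) p x) has_real_derivative \<sigma> * sqd2 (r t) p x) (at x)"
    "((\<lambda>x. \<sigma> * sqd2 (r t) p x) has_real_derivative \<sigma> * sqd3 (r t) p x) (at x)"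
  using oval.sqd1_deriv[OF oval_at] oval.sqd2_deriv[OF oval_at] assms
  by (auto intro!: DERIV_cmult)

text \<open>
  If \<open>p\<close> is on the evolute, \<open>\<sigma> * sqd1\<close> is a strictly convex function on \<open>J\<close> touching zero.
\<close>
lemma positive_off_double_zero:
  assumes "t \<in> I" "\<forall>x\<in>J. \<sigma> * sqd3 (r t) p x > 0"
    and "z \<in> J" "sqd1 (r t) p z = 0" "sqd2 (r t) p z = 0" "x \<in> J" "x \<noteq> z"
  shows "\<sigma> * sqd1 (r t) p x > 0"
  by (rule double_zero_positive[OF scaled_derivs[OF assms(1)], where u = "\<tau>0-e" and v = "\<tau>0+e" and z = z])
    (use assms in auto)

lemma zero_at_ts: "sqd1 (r ts) (q ts) \<tau>0 = 0" "sqd2 (r ts) (q ts) \<tau>0 = 0"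
  using oval.evolute_iff[OF oval_at[OF ts]] meet by blast+

lemma positive_at_ts: "x \<in> J \<Longrightarrow> x \<noteq> \<tau>0 \<Longrightarrow> \<sigma> * sqd1 (r ts) (q ts) x > 0"
  by (rule positive_off_double_zero[OF ts _ _ zero_at_ts]) (use fold e in auto)

text \<open>
  A degenerate zero in \<open>K\<close> would be a second parameter of the point \<open>q ts\<close> of the evolute within
  the period.
\<close>
lemma simple_on_K_at_ts:
  assumes "x \<in> K"
  shows "sqd1 (r ts) (q ts) x \<noteq> 0 \<or> sqd2 (r ts) (q ts) x \<noteq> 0"
proof (rule ccontr)
  assume "\<not> ?thesis"
  then have "q ts = evolute (r ts) x" using oval.evolute_iff[OF oval_at[OF ts]] by blast
  then obtain k :: int where k: "x = \<tau>0 + of_int k * (b - a)" using once meet by metis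
  have "e \<le> of_int k * (b - a)" "of_int k * (b - a) \<le> (b - a) - e"
    using assms k by auto
  then have "0 < of_int k * (b - a)" "of_int k * (b - a) < b - a"
    using e(1) by linarith+
  then have "0 < real_of_int k" "real_of_int k < 1"
    using e mult_less_cancel_right_pos[of "b - a" 0 "of_int k"] mult_less_cancel_right_pos[of "b - a" "of_int k" 1]
    by auto
  then show False by simp
qed

lemma eventually_near_fold: "\<forall>\<^sub>F s in nhds (ts, q ts). near_fold (fst s) (snd s)"
proof -
  have I: "open (I \<times> (UNIV :: (real^2) set))" "(ts, q ts) \<in> I \<times> UNIV"
    using ts by (auto intro!: open_Times)
  have in_I: "\<forall>\<^sub>F s in nhds (ts, q ts). fst s \<in> I"
    using I unfolding eventually_nhds by force
  note tube = eventually_positive_on_compact[OF I]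
  note cont = continuous_on_sqd[of "(I \<times> UNIV) \<times> UNIV" "\<lambda>u. fst (fst u)" "\<lambda>u. snd (fst u)" "\<lambda>u. snd u"]
  have c: "continuous_on ((I \<times> UNIV) \<times> UNIV) (\<lambda>u. sqd1 (r (fst (fst u))) (snd (fst u)) (snd u))"
    "continuous_on ((I \<times> UNIV) \<times> UNIV) (\<lambda>u. sqd2 (r (fst (fst u))) (snd (fst u)) (snd u))"
    "continuous_on ((I \<times> UNIV) \<times> UNIV) (\<lambda>u. sqd3 (r (fst (fst u))) (snd (fst u)) (snd u))"
    by (rule cont; auto intro!: continuous_intros)+
  have "\<forall>\<^sub>F s in nhds (ts, q ts). \<forall>x\<in>J. \<sigma> * sqd3 (r (fst s)) (snd s) x > 0"
    by (rule tube) (use fold in \<open>auto intro!: continuous_on_mult c\<close>)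
  moreover have "\<forall>\<^sub>F s in nhds (ts, q ts). \<forall>x\<in>{\<tau>0-e,\<tau>0+e}. \<sigma> * sqd1 (r (fst s)) (snd s) x > 0"
    by (rule tube) (use positive_at_ts e in \<open>auto intro!: continuous_on_mult c\<close>)
  moreover have "\<forall>\<^sub>F s in nhds (ts, q ts). \<forall>x\<in>K. max \<bar>sqd1 (r (fst s)) (snd s) x\<bar> \<bar>sqd2 (r (fst s)) (snd s) x\<bar> > 0"
    by (rule tube) (use simple_on_K_at_ts in \<open>auto intro!: continuous_on_max continuous_on_rabs c simp: less_max_iff_disj\<close>)
  ultimately show ?thesis
    using in_I by eventually_elim (auto simp: near_fold_def less_max_iff_disj)
qed

lemma q_tendsto: "(q \<longlongrightarrow> q ts) (nhds ts)"
proof -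
  have "continuous_on I q" by (rule continuous_on_subset[OF path]) auto
  then have "isCont q ts"
    using ts by (auto simp: continuous_on_eq_continuous_at)
  then show ?thesis by (simp add: isCont_def tendsto_at_iff_tendsto_nhds)
qed

lemma eventually_near_fold_on_path: "\<forall>\<^sub>F t in nhds ts. near_fold t (q t)"
proof -
  have "((\<lambda>t. (t, q t)) \<longlongrightarrow> (ts, q ts)) (nhds ts)"
    by (intro tendsto_Pair q_tendsto) (simp add: filterlim_ident)
  from eventually_compose_filterlim[OF eventually_near_fold this] show ?thesis by simp
qed

lemma on_evolute_iff:
  assumes "near_fold t p"
  shows "p \<in> range (evolute (r t)) \<longleftrightarrow> (\<exists>x\<in>J. sqd1 (r t) p x = 0 \<and> sqd2 (r t) p x = 0)"
proof -
  interpret o: oval a b "r t" using assms oval_at by (simp add: near_fold_def)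
  have "x \<in> J" if "x \<in> {\<tau>0-e..<\<tau>0-e + (b-a)}" "sqd1 (r t) p x = 0" "sqd2 (r t) p x = 0" for x
  proof -
    have "x \<notin> K" using assms that by (auto simp: near_fold_def)
    then show ?thesis using that e by auto
  qed
  then show ?thesis
    unfolding o.range_evolute_iff[of p "\<tau>0-e"] using e by (auto 4 3)
qed

text \<open>
  If \<open>p\<close> is on neither side, \<open>\<sigma> * sqd1\<close> has minimum zero on \<open>J\<close>; the minimum is not at an end of \<open>J\<close>, so
  the derivative vanishes there as well and \<open>p\<close> is a center of curvature.
\<close>
lemma off_evolute_iff:
  assumes g: "near_fold t p"
  shows "p \<notin> range (evolute (r t)) \<longleftrightarrow> p \<in> inner_side t \<or> p \<in> outer_side t"
proof
  assume "p \<in> inner_side t \<or> p \<in> outer_side t"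
  moreover have False if x: "x \<in> J" "sqd1 (r t) p x = 0" "sqd2 (r t) p x = 0" and p: "p \<in> inner_side t \<or> p \<in> outer_side t" for x
  proof -
    have "\<sigma> * sqd1 (r t) p y \<ge> 0" if "y \<in> J" for y
      using positive_off_double_zero[of t p x y] g x that by (cases "y = x") (auto simp: near_fold_def)
    then have "p \<notin> outer_side t" by (force simp: outer_side_def)
    moreover have "p \<notin> inner_side t" using x by (force simp: inner_side_def)
    ultimately show False using p by blast
  qed
  ultimately show "p \<notin> range (evolute (r t))" using on_evolute_iff[OF g] by blast
next
  assume off: "p \<notin> range (evolute (r t))"
  show "p \<in> inner_side t \<or> p \<in> outer_side t"
  proof (rule ccontr)
    assume "\<not> ?thesis"
    then have nonneg: "\<And>y. y \<in> J \<Longrightarrow> \<sigma> * sqd1 (r t) p y \<ge> 0" and "\<exists>x\<in>J. \<sigma> * sqd1 (r t) p x \<le> 0"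
      by (auto simp: inner_side_def outer_side_def not_less)
    then obtain x where x: "x \<in> J" "\<sigma> * sqd1 (r t) p x \<le> 0" by blast
    have zero: "\<sigma> * sqd1 (r t) p x = 0" using x nonneg[of x] by simp
    then have "x \<noteq> \<tau>0-e" "x \<noteq> \<tau>0+e" using g by (auto simp: near_fold_def)
    then have d: "min (x - (\<tau>0-e)) (\<tau>0+e - x) > 0" using x by auto
    have "\<sigma> * sqd2 (r t) p x = 0"
    proof (rule DERIV_local_min[OF scaled_derivs(1) d])
      show "t \<in> I" using g by (simp add: near_fold_def)
      show "\<forall>y. \<bar>x - y\<bar> < min (x - (\<tau>0-e)) (\<tau>0+e - x) \<longrightarrow> \<sigma> * sqd1 (r t) p x \<le> \<sigma> * sqd1 (r t) p y"
        unfolding zero by (intro allI impI nonneg) auto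
    qed
    then show False using off zero x(1) \<sigma>_nz on_evolute_iff[OF g] by auto
  qed
qed

lemma inner_outer_disjoint: "inner_side t \<inter> outer_side t = {}"
  by (force simp: inner_side_def outer_side_def)

lemma scaled_sqd1_affine:
  "u + v = 1 \<Longrightarrow> \<sigma> * sqd1 (r t) (u *\<^sub>R p + v *\<^sub>R p') x = u * (\<sigma> * sqd1 (r t) p x) + v * (\<sigma> * sqd1 (r t) p' x)"
proof -
  assume "u + v = 1"
  then have v: "v = 1 - u" by simp
  show ?thesis unfolding v sqd1_def by (simp add: inner_diff_left inner_add_left algebra_simps)
qed

lemma convex_inner: "convex (inner_side t)"
proof (rule convexI)
  fix p p' :: "real^2" and u v :: real
  assume p: "p \<in> inner_side t" "p' \<in> inner_side t" and uv: "0 \<le> u" "0 \<le> v" "u + v = 1"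
  have "u * y + v * z > 0" if "y > 0" "z > 0" for y z :: real
    using that uv by (cases "u = 0") (auto intro: add_pos_nonneg)
  then show "u *\<^sub>R p + v *\<^sub>R p' \<in> inner_side t"
    using p by (simp add: inner_side_def scaled_sqd1_affine[OF uv(3)])
qed

lemma open_inner:
  assumes "t \<in> I"
  shows "open (inner_side t)"
proof (subst open_subopen, intro ballI)
  fix p assume p: "p \<in> inner_side t"
  have c: "continuous_on (UNIV \<times> UNIV) (\<lambda>u. sqd1 (r t) (fst u) (snd u))"
    by (rule continuous_on_sqd) (use assms in \<open>auto intro!: continuous_intros\<close>)
  have "\<forall>\<^sub>F p' in nhds p. \<forall>x\<in>J. \<sigma> * sqd1 (r t) p' x > 0"
    by (rule eventually_positive_on_compact[of UNIV])
      (use p c in \<open>auto simp: inner_side_def intro!: continuous_on_mult\<close>)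
  then show "\<exists>T. open T \<and> p \<in> T \<and> T \<subseteq> inner_side t"
    by (auto simp: eventually_nhds inner_side_def)
qed

lemma open_outer: "open (outer_side t)"
proof -
  have "outer_side t = (\<Union>x\<in>J. {p. \<sigma> * sqd1 (r t) p x < 0})"
    by (auto simp: outer_side_def)
  moreover have "open {p. \<sigma> * sqd1 (r t) p x < 0}" for x
    unfolding sqd1_def by (intro open_Collect_less continuous_intros)
  ultimately show ?thesis by auto
qed

lemma evolute_tendsto: "((\<lambda>t. evolute (r t) x) \<longlongrightarrow> evolute (r ts) x) (nhds ts)"
proof -
  have "continuous_on I (\<lambda>t. evolute (r t) x)"
    by (rule continuous_on_evolute) (auto intro!: continuous_intros)
  then have "isCont (\<lambda>t. evolute (r t) x) ts"
    using ts by (auto simp: continuous_on_eq_continuous_at)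
  then show ?thesis by (simp add: isCont_def tendsto_at_iff_tendsto_nhds[of "\<lambda>t. evolute (r t) x" ts])
qed

text \<open>
  The given neighbourhood \<open>V\<close> may be large, and the evolute may behave differently far out in it; the comparison takes place in a
  ball \<open>W\<close> inside \<open>V\<close> in which \<open>near_fold\<close> holds.
\<close>
lemma eventually_sides:
  assumes V: "open V" "q ts \<in> V"
    and sides: "\<forall>\<^sub>F t in nhds ts. convex_concave_sides (range (evolute (r t))) V (A t) (B t)"
  shows "\<forall>\<^sub>F t in nhds ts. (q t \<in> A t \<longrightarrow> q t \<in> inner_side t) \<and> (q t \<in> B t \<longrightarrow> q t \<in> outer_side t)"
proof -
  obtain G H where GH: "eventually G (nhds ts)" "eventually H (nhds (q ts))" "\<And>t p. G t \<Longrightarrow> H p \<Longrightarrow> near_fold t p"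
    using eventually_near_fold unfolding nhds_prod eventually_prod_filter by auto
  have "\<forall>\<^sub>F p in nhds (q ts). H p \<and> p \<in> V"
    using GH(2) eventually_nhds_in_open[OF V] by (rule eventually_conj)
  then obtain d where d: "d > 0" "\<And>p. dist p (q ts) < d \<Longrightarrow> H p \<and> p \<in> V"
    unfolding eventually_nhds_metric by blast
  define W where "W = ball (q ts) d"
  have W: "open W" "convex W" "W \<subseteq> V" "q ts \<in> W" "\<And>p. p \<in> W \<Longrightarrow> H p"
    using d by (auto simp: W_def dist_commute)
  \<comment> \<open>The midpoint of the evolute points at \<open>\<tau>0\<close> and \<open>x1\<close>, both in \<open>W\<close>, will turn out to be on the inner side.\<close>
  have "\<forall>\<^sub>F x in at_right \<tau>0. evolute (r ts) x \<in> W"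
  proof (rule topological_tendstoD)
    have "isCont (evolute (r ts)) \<tau>0"
      using oval.evolute_differentiable[OF oval_at[OF ts]] differentiable_imp_continuous_within by blast
    then show "(evolute (r ts) \<longlongrightarrow> evolute (r ts) \<tau>0) (at_right \<tau>0)"
      unfolding isCont_def by (rule tendsto_within_subset) auto
  qed (use W meet in auto)
  moreover have "\<forall>\<^sub>F x in at_right \<tau>0. x \<in> {\<tau>0<..<\<tau>0+e}"
    using e by (intro eventually_at_right_real) auto
  ultimately have "\<exists>x. evolute (r ts) x \<in> W \<and> x \<in> {\<tau>0<..<\<tau>0+e}"
    using eventually_happens[OF eventually_conj] trivial_limit_at_right_real by blast
  then obtain x1 where x1: "evolute (r ts) x1 \<in> W" "x1 \<in> {\<tau>0<..<\<tau>0+e}" by blast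
  have near: "\<forall>\<^sub>F t in nhds ts. evolute (r t) x1 \<in> W" "\<forall>\<^sub>F t in nhds ts. evolute (r t) \<tau>0 \<in> W"
    using topological_tendstoD[OF evolute_tendsto W(1)] x1 W meet by auto
  have "\<forall>\<^sub>F t in nhds ts. q t \<in> W"
    using topological_tendstoD[OF q_tendsto W(1)] W by auto
  then show ?thesis
    using near GH(1) sides
  proof eventually_elim
    case (elim t)
    let ?\<Gamma> = "range (evolute (r t))"
    define e1 e2 where "e1 = evolute (r t) \<tau>0" and "e2 = evolute (r t) x1"
    have good: "near_fold t p" if "p \<in> W" for p using GH(3) elim W that by blast
    have t: "t \<in> I" using good[OF W(4)] by (simp add: near_fold_def)
    have zeros: "sqd1 (r t) e1 \<tau>0 = 0" "sqd2 (r t) e1 \<tau>0 = 0" "sqd1 (r t) e2 x1 = 0" "sqd2 (r t) e2 x1 = 0"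
      using oval.evolute_iff[OF oval_at[OF t]] by (auto simp: e1_def e2_def)
    have eW: "e1 \<in> W" "e2 \<in> W" using elim by (auto simp: e1_def e2_def)
    \<comment> \<open>For \<open>e1\<close> the convex function touches zero only at \<open>\<tau>0\<close>, for \<open>e2\<close> only at \<open>x1\<close>, so their average is positive.\<close>
    have mid: "midpoint e1 e2 \<in> inner_side t"
      unfolding inner_side_def
    proof (intro CollectI ballI)
      fix x assume x: "x \<in> J"
      have 1: "x = \<tau>0 \<or> \<sigma> * sqd1 (r t) e1 x > 0"
        using positive_off_double_zero[OF t _ _ zeros(1,2) x] good[OF eW(1)] e by (auto simp: near_fold_def)
      have 2: "x = x1 \<or> \<sigma> * sqd1 (r t) e2 x > 0"
        using positive_off_double_zero[OF t _ _ zeros(3,4) x] good[OF eW(2)] x1 by (auto simp: near_fold_def)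
      have "midpoint e1 e2 = (1/2) *\<^sub>R e1 + (1/2) *\<^sub>R e2"
        by (simp add: midpoint_def scaleR_add_right inverse_eq_divide)
      then have "\<sigma> * sqd1 (r t) (midpoint e1 e2) x = 1/2 * (\<sigma> * sqd1 (r t) e1 x) + 1/2 * (\<sigma> * sqd1 (r t) e2 x)"
        by (simp only:) (rule scaled_sqd1_affine, simp)
      moreover have "\<sigma> * sqd1 (r t) e1 x \<ge> 0" "\<sigma> * sqd1 (r t) e2 x \<ge> 0"
        using 1 2 zeros by auto
      moreover have "\<sigma> * sqd1 (r t) e1 x > 0 \<or> \<sigma> * sqd1 (r t) e2 x > 0"
        using 1 2 x1 by auto
      ultimately show "\<sigma> * sqd1 (r t) (midpoint e1 e2) x > 0" by linarith
    qed
    have midW: "midpoint e1 e2 \<in> W"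
      using eW W(2) by (metis closed_segment_subset midpoint_in_closed_segment subsetD)
    have cc: "components (V - ?\<Gamma>) = {A t, B t}" "A t \<noteq> B t" "?\<Gamma> \<inter> V \<subseteq> frontier (A t)" "convex (A t)"
      using elim(5) by (auto simp: convex_concave_sides_def)
    have part: "W - ?\<Gamma> = (inner_side t \<inter> W) \<union> (outer_side t \<inter> W)"
      using off_evolute_iff good by blast
    have "inner_side t \<inter> W \<inter> (outer_side t \<inter> W) = {}" using inner_outer_disjoint by blast
    then have "A t \<inter> W \<subseteq> inner_side t \<inter> W" "B t \<inter> W \<subseteq> outer_side t \<inter> W"
      using convex_component_is_positive_side[OF cc W(2,3) _ _ _ _ part, of e1 e2]
        open_inner[OF t] open_outer convex_inner W(1,2) eW mid midW
      by (auto simp: e1_def e2_def open_Int convex_Int)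
    then show ?case using elim(1) by blast
  qed
qed

definition zeros_J :: "real \<Rightarrow> real set" where
  "zeros_J t = {x\<in>J. sqd1 (r t) (q t) x = 0}"

definition zeros_K :: "real \<Rightarrow> real set" where
  "zeros_K t = {x\<in>K. sqd1 (r t) (q t) x = 0}"

text \<open>
  The ends of \<open>J\<close> are not equilibria, so the period that starts at the left end of \<open>J\<close> splits cleanly.
\<close>
lemma zeros_split:
  assumes g: "near_fold t (q t)"
  shows "{x. sqd1 (r t) (q t) x = 0} \<inter> {\<tau>0-e..<\<tau>0-e + (b-a)} = zeros_J t \<union> zeros_K t"
    "zeros_J t \<inter> zeros_K t = {}"
proof -
  interpret o: oval a b "r t" using g oval_at by (simp add: near_fold_def)
  have nz: "sqd1 (r t) (q t) (\<tau>0+e) \<noteq> 0" "sqd1 (r t) (q t) (\<tau>0-e + (b-a)) \<noteq> 0"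
    using g unfolding o.sqd_periodic by (auto simp: near_fold_def)
  have *: "x \<noteq> \<tau>0+e \<and> x \<noteq> \<tau>0-e + (b-a)" if "sqd1 (r t) (q t) x = 0" for x
    using that nz by auto
  show "{x. sqd1 (r t) (q t) x = 0} \<inter> {\<tau>0-e..<\<tau>0-e + (b-a)} = zeros_J t \<union> zeros_K t"
    using e by (force simp: zeros_J_def zeros_K_def dest: *)
  show "zeros_J t \<inter> zeros_K t = {}"
    by (auto simp: zeros_J_def zeros_K_def dest: *)
qed

lemma continuous_q:
  "continuous_on (I \<times> UNIV) (\<lambda>u. sqd1 (r (fst u)) (q (fst u)) (snd u))"
  "continuous_on (I \<times> UNIV) (\<lambda>u. sqd2 (r (fst u)) (q (fst u)) (snd u))"
proof -
  have q: "continuous_on (I \<times> UNIV) (\<lambda>u. q (fst u))"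
    by (rule continuous_on_compose2[OF path]) (auto intro!: continuous_intros)
  show "continuous_on (I \<times> UNIV) (\<lambda>u. sqd1 (r (fst u)) (q (fst u)) (snd u))"
    "continuous_on (I \<times> UNIV) (\<lambda>u. sqd2 (r (fst u)) (q (fst u)) (snd u))"
    by (rule continuous_on_sqd[of "I \<times> UNIV" fst "\<lambda>u. q (fst u)" snd, OF _ q]; auto intro!: continuous_intros)+
qed

lemma D_tendsto:
  assumes "k \<le> 3" "(\<zeta> \<longlongrightarrow> z) (nhds ts)"
  shows "((\<lambda>t. D k (r t) (\<zeta> t)) \<longlongrightarrow> D k (r ts) z) (nhds ts)"
proof -
  have "continuous_on (I \<times> UNIV) (\<lambda>u. D k (r (fst u)) (snd u))"
    by (rule continuous_on_D[OF assms(1)]) (auto intro!: continuous_intros)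
  moreover have "open (I \<times> (UNIV :: real set))" by (intro open_Times) auto
  ultimately have "isCont (\<lambda>u. D k (r (fst u)) (snd u)) (ts, z)"
    using ts by (subst (asm) continuous_on_eq_continuous_at) auto
  from isCont_tendsto_compose[OF this tendsto_Pair[OF _ assms(2)], of "\<lambda>t. t"]
  show ?thesis by (simp add: filterlim_ident)
qed

lemma index_sum_tendsto:
  assumes "(\<zeta> \<longlongrightarrow> z) (nhds ts)" "sqd2 (r ts) (q ts) z \<noteq> 0"
  shows "((\<lambda>t. index_sum (r t) (q t) (\<zeta> t)) \<longlongrightarrow> index_sum (r ts) (q ts) z) (nhds ts)"
proof -
  note D = D_tendsto[OF _ assms(1)]
  have "((\<lambda>t. r t (\<zeta> t)) \<longlongrightarrow> r ts z) (nhds ts)" using D[of 0] by simp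
  then show ?thesis
    using assms(2) unfolding index_sum_def sqd2_def by (intro tendsto_intros D q_tendsto) auto
qed

lemma zeros_K_stable:
  obtains n L where "\<forall>\<^sub>F t in nhds ts. finite (zeros_K t) \<and> card (zeros_K t) = n"
    "((\<lambda>t. \<Sum>x\<in>zeros_K t. index_sum (r t) (q t) x) \<longlongrightarrow> L) (nhds ts)"
proof -
  interpret o: oval a b "r ts" using ts oval_at by blast
  have ends: "sqd1 (r ts) (q ts) (\<tau>0+e) \<noteq> 0" "sqd1 (r ts) (q ts) (\<tau>0+(b-a)-e) \<noteq> 0"
    using positive_at_ts[of "\<tau>0+e"] positive_at_ts[of "\<tau>0-e"] e o.sqd_periodic(1)[of "q ts" "\<tau>0-e"]
    by (auto simp: algebra_simps)
  have simple: "sqd2 (r ts) (q ts) x \<noteq> 0" if "x \<in> K" "sqd1 (r ts) (q ts) x = 0" for x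
    using simple_on_K_at_ts that by blast
  obtain \<zeta> where fin: "finite (zeros_K ts)"
    and lim: "\<And>z. z \<in> zeros_K ts \<Longrightarrow> (\<zeta> z \<longlongrightarrow> z) (nhds ts)"
    and bij: "\<forall>\<^sub>F t in nhds ts. bij_betw (\<lambda>z. \<zeta> z t) (zeros_K ts) (zeros_K t)"
    unfolding zeros_K_def
    by (rule simple_zeros_persist[of I ts "\<lambda>t. sqd1 (r t) (q t)" "\<lambda>t. sqd2 (r t) (q t)" "\<tau>0+e" "\<tau>0+(b-a)-e"])
      (use ts continuous_q oval.sqd1_deriv[OF oval_at] simple ends in auto)
  have "((\<lambda>t. \<Sum>z\<in>zeros_K ts. index_sum (r t) (q t) (\<zeta> z t)) \<longlongrightarrow>
      (\<Sum>z\<in>zeros_K ts. index_sum (r ts) (q ts) z)) (nhds ts)"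
    by (intro tendsto_sum index_sum_tendsto lim simple) (auto simp: zeros_K_def)
  moreover have "\<forall>\<^sub>F t in nhds ts. (\<Sum>z\<in>zeros_K ts. index_sum (r t) (q t) (\<zeta> z t)) = (\<Sum>x\<in>zeros_K t. index_sum (r t) (q t) x)"
    using bij by eventually_elim (rule sum.reindex_bij_betw)
  ultimately have "((\<lambda>t. \<Sum>x\<in>zeros_K t. index_sum (r t) (q t) x) \<longlongrightarrow>
      (\<Sum>z\<in>zeros_K ts. index_sum (r ts) (q ts) z)) (nhds ts)"
    by (rule Lim_transform_eventually)
  moreover have "\<forall>\<^sub>F t in nhds ts. finite (zeros_K t) \<and> card (zeros_K t) = card (zeros_K ts)"
    using bij by eventually_elim (use fin in \<open>simp add: bij_betw_finite bij_betw_same_card\<close>)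
  ultimately show thesis using that by blast
qed

lemma zeros_J_inner: "q t \<in> inner_side t \<Longrightarrow> zeros_J t = {}"
  by (force simp: inner_side_def zeros_J_def)

lemma zeros_J_outer:
  assumes g: "near_fold t (q t)" and N: "q t \<in> outer_side t"
  shows "card (zeros_J t) = 2"
proof -
  have t: "t \<in> I" using g by (simp add: near_fold_def)
  obtain w where w: "w \<in> J" "\<sigma> * sqd1 (r t) (q t) w < 0" using N by (auto simp: outer_side_def)
  have "card {x\<in>J. \<sigma> * sqd1 (r t) (q t) x = 0} = 2"
    by (rule convex_function_two_zeros[OF scaled_derivs[OF t] _ _ _ w]) (use g in \<open>auto simp: near_fold_def\<close>)
  then show ?thesis using \<sigma>_nz by (simp add: zeros_J_def)
qed

text \<open>
  At the critical time the only zero in \<open>J\<close> is \<open>\<tau>0\<close>, and the denominator of the index sum vanishes there while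
  the numerator does not. By compactness of \<open>J\<close> the quotient is large at all zeros in \<open>J\<close> at nearby times, so
  there is no need to follow the individual zeros.
\<close>
lemma index_blow_up:
  "\<forall>\<^sub>F t in nhds ts. \<forall>x\<in>zeros_J t. sqd2 (r t) (q t) x \<noteq> 0 \<longrightarrow> index_sum (r t) (q t) x \<ge> C"
proof -
  define num where "num t x = D 1 (r t) x \<bullet> D 1 (r t) x + \<bar>(r t x - q t) \<bullet> D 2 (r t) x\<bar>" for t x
  note D = continuous_on_D[of _ "I \<times> UNIV" fst snd]
  have "continuous_on (I \<times> UNIV) (\<lambda>u. q (fst u))"
    by (rule continuous_on_compose2[OF path]) (auto intro!: continuous_intros)
  moreover have "continuous_on (I \<times> UNIV) (\<lambda>u. D 0 (r (fst u)) (snd u))"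
    by (rule D) (auto intro!: continuous_intros)
  then have "continuous_on (I \<times> UNIV) (\<lambda>u. r (fst u) (snd u))" by simp
  ultimately have cn: "continuous_on (I \<times> UNIV) (\<lambda>u. num (fst u) (snd u))"
    unfolding num_def by (intro continuous_intros D) auto
  have "\<forall>\<^sub>F t in nhds ts. \<forall>x\<in>J. max \<bar>sqd1 (r t) (q t) x\<bar> (num t x - C * \<bar>sqd2 (r t) (q t) x\<bar>) > 0"
  proof (rule eventually_positive_on_compact[of I])
    show "continuous_on (I \<times> UNIV)
      (\<lambda>u. max \<bar>sqd1 (r (fst u)) (q (fst u)) (snd u)\<bar> (num (fst u) (snd u) - C * \<bar>sqd2 (r (fst u)) (q (fst u)) (snd u)\<bar>))"
      by (intro continuous_intros continuous_q cn)
    fix x assume "x \<in> J"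
    show "max \<bar>sqd1 (r ts) (q ts) x\<bar> (num ts x - C * \<bar>sqd2 (r ts) (q ts) x\<bar>) > 0"
    proof (cases "x = \<tau>0")
      case True
      have "D 1 (r ts) \<tau>0 \<bullet> D 1 (r ts) \<tau>0 > 0" using oval.D1_pos[OF oval_at[OF ts]] .
      then show ?thesis using True zero_at_ts by (simp add: num_def less_max_iff_disj add_pos_nonneg)
    next
      case False
      then show ?thesis using positive_at_ts[OF \<open>x \<in> J\<close>] by (auto simp: less_max_iff_disj)
    qed
  qed (use ts in auto)
  then show ?thesis
    by eventually_elim
      (auto simp: zeros_J_def index_sum_def num_def less_max_iff_disj pos_le_divide_eq intro: less_imp_le)
qed

lemma equilibria_split:
  assumes g: "near_fold t (q t)" and fin: "finite (zeros_K t)" "finite (zeros_J t)"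
  shows "equilibrium_number a b (r t) (q t) = card (zeros_K t) + card (zeros_J t)"
    "N0 a b (r t) (q t) = (\<Sum>x\<in>zeros_K t. index_sum (r t) (q t) x) + (\<Sum>x\<in>zeros_J t. index_sum (r t) (q t) x)"
proof -
  interpret o: oval a b "r t" using g oval_at by (simp add: near_fold_def)
  show "equilibrium_number a b (r t) (q t) = card (zeros_K t) + card (zeros_J t)"
    unfolding o.equilibrium_sums(3) o.equilibrium_sums(1)[of "q t" "\<tau>0-e"] zeros_split(1)[OF g]
    using card_Un_disjoint[OF fin(2,1) zeros_split(2)[OF g]] by simp
  show "N0 a b (r t) (q t) = (\<Sum>x\<in>zeros_K t. index_sum (r t) (q t) x) + (\<Sum>x\<in>zeros_J t. index_sum (r t) (q t) x)"
    unfolding o.equilibrium_sums(2)[of "q t" "\<tau>0-e"] zeros_split(1)[OF g]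
    using sum.union_disjoint[OF fin(2,1) zeros_split(2)[OF g]] by (simp add: add.commute)
qed

text \<open>
  The filter \<open>F\<close> stands for either one-sided approach to the critical time; \<open>n\<close> and \<open>L\<close> do not
  depend on it because they describe the zeros in \<open>K\<close>, which continue through the critical time.
\<close>
lemma equilibria_near_fold:
  obtains n L where
    "\<And>F. F \<le> nhds ts \<Longrightarrow> \<forall>\<^sub>F t in F. q t \<in> inner_side t \<Longrightarrow>
      (\<forall>\<^sub>F t in F. equilibrium_number a b (r t) (q t) = n) \<and> ((\<lambda>t. N0 a b (r t) (q t)) \<longlongrightarrow> L) F"
    "\<And>F. F \<le> nhds ts \<Longrightarrow> \<forall>\<^sub>F t in F. q t \<in> outer_side t \<Longrightarrow>
      (\<forall>\<^sub>F t in F. equilibrium_number a b (r t) (q t) = n + 2) \<and> filterlim (\<lambda>t. N0 a b (r t) (q t)) at_top F"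
proof -
  obtain n L where n: "\<forall>\<^sub>F t in nhds ts. finite (zeros_K t) \<and> card (zeros_K t) = n"
    and L: "((\<lambda>t. \<Sum>x\<in>zeros_K t. index_sum (r t) (q t) x) \<longlongrightarrow> L) (nhds ts)"
    by (rule zeros_K_stable)
  show thesis
  proof (rule that)
    fix F assume F: "F \<le> nhds ts" and P: "\<forall>\<^sub>F t in F. q t \<in> inner_side t"
    note ev = filter_leD[OF F n] filter_leD[OF F eventually_near_fold_on_path] P
    have "\<forall>\<^sub>F t in F. equilibrium_number a b (r t) (q t) = n"
      using ev by eventually_elim (simp add: equilibria_split zeros_J_inner)
    moreover have "\<forall>\<^sub>F t in F. (\<Sum>x\<in>zeros_K t. index_sum (r t) (q t) x) = N0 a b (r t) (q t)"
      using ev by eventually_elim (simp add: equilibria_split zeros_J_inner)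
    then have "((\<lambda>t. N0 a b (r t) (q t)) \<longlongrightarrow> L) F"
      by (rule Lim_transform_eventually[OF tendsto_mono[OF F L]])
    ultimately show "(\<forall>\<^sub>F t in F. equilibrium_number a b (r t) (q t) = n) \<and> ((\<lambda>t. N0 a b (r t) (q t)) \<longlongrightarrow> L) F" ..
  next
    fix F assume F: "F \<le> nhds ts" and N: "\<forall>\<^sub>F t in F. q t \<in> outer_side t"
    note ev = filter_leD[OF F n] filter_leD[OF F eventually_near_fold_on_path] N
    have fin: "finite (zeros_J t)" if "near_fold t (q t)" "q t \<in> outer_side t" for t
      using zeros_J_outer[OF that] card.infinite by fastforce
    have "\<forall>\<^sub>F t in F. equilibrium_number a b (r t) (q t) = n + 2"
      using ev by eventually_elim (simp add: equilibria_split zeros_J_outer fin)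
    moreover have "filterlim (\<lambda>t. \<Sum>x\<in>zeros_J t. index_sum (r t) (q t) x) at_top F"
      unfolding filterlim_at_top
    proof
      fix C :: real
      show "\<forall>\<^sub>F t in F. C \<le> (\<Sum>x\<in>zeros_J t. index_sum (r t) (q t) x)"
        using ev filter_leD[OF F index_blow_up[of "C / 2"]]
      proof eventually_elim
        case (elim t)
        have t: "t \<in> I" using elim by (simp add: near_fold_def)
        have "q t \<notin> range (evolute (r t))" using elim off_evolute_iff by blast
        then have "sqd2 (r t) (q t) x \<noteq> 0" if "x \<in> zeros_J t" for x
          using that oval.evolute_iff[OF oval_at[OF t], of "q t" x] by (auto simp: zeros_J_def)
        then have "index_sum (r t) (q t) x \<ge> C / 2" if "x \<in> zeros_J t" for x
          using that elim(4) by blast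
        from sum_bounded_below[OF this, of "zeros_J t"] show ?case
          using zeros_J_outer[OF elim(2,3)] by simp
      qed
    qed
    then have "filterlim (\<lambda>t. (\<Sum>x\<in>zeros_K t. index_sum (r t) (q t) x) + (\<Sum>x\<in>zeros_J t. index_sum (r t) (q t) x)) at_top F"
      by (rule filterlim_tendsto_add_at_top[OF tendsto_mono[OF F L]])
    moreover have "filterlim (\<lambda>t. (\<Sum>x\<in>zeros_K t. index_sum (r t) (q t) x) + (\<Sum>x\<in>zeros_J t. index_sum (r t) (q t) x)) at_top F
        \<longleftrightarrow> filterlim (\<lambda>t. N0 a b (r t) (q t)) at_top F"
      by (rule filterlim_cong[OF refl refl]) (use ev in \<open>eventually_elim, simp add: equilibria_split fin\<close>)
    ultimately show "(\<forall>\<^sub>F t in F. equilibrium_number a b (r t) (q t) = n + 2) \<and> filterlim (\<lambda>t. N0 a b (r t) (q t)) at_top F"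
      by blast
  qed
qed

lemma eventually_generic:
  assumes "F \<le> nhds ts" "\<forall>\<^sub>F t in F. q t \<in> inner_side t \<or> q t \<in> outer_side t"
  shows "\<forall>\<^sub>F t in F. generic_equilibria a b (r t) (q t)"
  using assms(2) filter_leD[OF assms(1) eventually_near_fold_on_path]
proof eventually_elim
  case (elim t)
  then have "t \<in> I" "q t \<notin> range (evolute (r t))"
    using off_evolute_iff by (auto simp: near_fold_def)
  then show ?case using oval.generic_if_off_evolute[OF oval_at] by blast
qed

lemma crossing_convex_to_concave:
  assumes "moves_convex_to_concave (\<lambda>t. range (evolute (r t))) q ts"
  shows "\<forall>\<^sub>F t in at_left ts. q t \<in> inner_side t" "\<forall>\<^sub>F t in at_right ts. q t \<in> outer_side t"
proof -
  obtain V A B where V: "open V" "q ts \<in> V"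
    "\<forall>\<^sub>F t in nhds ts. convex_concave_sides (range (evolute (r t))) V (A t) (B t)"
    and AB: "\<forall>\<^sub>F t in at_left ts. q t \<in> A t" "\<forall>\<^sub>F t in at_right ts. q t \<in> B t"
    using assms unfolding moves_convex_to_concave_def by blast
  note sides = eventually_sides[OF V]
  show "\<forall>\<^sub>F t in at_left ts. q t \<in> inner_side t"
    using AB(1) filter_leD[OF at_within_le_nhds sides] by eventually_elim blast
  show "\<forall>\<^sub>F t in at_right ts. q t \<in> outer_side t"
    using AB(2) filter_leD[OF at_within_le_nhds sides] by eventually_elim blast
qed

lemma crossing_concave_to_convex:
  assumes "moves_concave_to_convex (\<lambda>t. range (evolute (r t))) q ts"
  shows "\<forall>\<^sub>F t in at_left ts. q t \<in> outer_side t" "\<forall>\<^sub>F t in at_right ts. q t \<in> inner_side t"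
proof -
  obtain V A B where V: "open V" "q ts \<in> V"
    "\<forall>\<^sub>F t in nhds ts. convex_concave_sides (range (evolute (r t))) V (A t) (B t)"
    and AB: "\<forall>\<^sub>F t in at_left ts. q t \<in> B t" "\<forall>\<^sub>F t in at_right ts. q t \<in> A t"
    using assms unfolding moves_concave_to_convex_def by blast
  note sides = eventually_sides[OF V]
  show "\<forall>\<^sub>F t in at_left ts. q t \<in> outer_side t"
    using AB(1) filter_leD[OF at_within_le_nhds sides] by eventually_elim blast
  show "\<forall>\<^sub>F t in at_right ts. q t \<in> inner_side t"
    using AB(2) filter_leD[OF at_within_le_nhds sides] by eventually_elim blast
qed

end

section \<open>Crossing the evolute\<close>

theorem theorem3:
  fixes a b t0 t1 ts \<tau>0 :: real
    and r :: "real \<Rightarrow> real \<Rightarrow> real^2"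
    and q :: "real \<Rightarrow> real^2"
  assumes "a < b" and "t0 < t1"
    and curves: "\<And>t. t \<in> {t0..t1} \<Longrightarrow>
          C3_curve (r t) \<and> regular_curve (r t) \<and> closed_convex_curve a b (r t) \<and>
          nonzero_curvature (r t)"
    and family: "\<And>k. k \<le> 3 \<Longrightarrow>
          continuous_on ({t0..t1} \<times> UNIV) (\<lambda>(t, \<tau>). D k (r t) \<tau>)"
    and path: "continuous_on {t0..t1} q"
    and "ts \<in> {t0<..<t1}" and "\<tau>0 \<in> {a..b}"
    and meet: "q ts = evolute (r ts) \<tau>0"
    and transversal: "transversely_intersects (\<lambda>t. range (evolute (r t))) q ts"
    and general: "general_point a b (r ts) \<tau>0"
    and convex: "locally_convex_at (range (evolute (r ts))) (evolute (r ts) \<tau>0)"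
  shows "(\<forall>\<^sub>F t in at ts. generic_equilibria a b (r t) (q t)) \<and>
    (moves_convex_to_concave (\<lambda>t. range (evolute (r t))) q ts \<longrightarrow>
       (\<exists>n. (\<forall>\<^sub>F t in at_left ts. equilibrium_number a b (r t) (q t) = n) \<and>
            (\<forall>\<^sub>F t in at_right ts. equilibrium_number a b (r t) (q t) = n + 2)) \<and>
       (\<exists>L. ((\<lambda>t. N0 a b (r t) (q t)) \<longlongrightarrow> L) (at_left ts)) \<and>
       filterlim (\<lambda>t. N0 a b (r t) (q t)) at_top (at_right ts)) \<and>
    (moves_concave_to_convex (\<lambda>t. range (evolute (r t))) q ts \<longrightarrow>
       (\<exists>n. (\<forall>\<^sub>F t in at_left ts. equilibrium_number a b (r t) (q t) = n + 2) \<and>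
            (\<forall>\<^sub>F t in at_right ts. equilibrium_number a b (r t) (q t) = n)) \<and>
       filterlim (\<lambda>t. N0 a b (r t) (q t)) at_top (at_left ts) \<and>
       (\<exists>L. ((\<lambda>t. N0 a b (r t) (q t)) \<longlongrightarrow> L) (at_right ts)))"
proof -
  have ovals: "oval a b (r t)" if "t \<in> {t0..t1}" for t
    using curves[OF that] \<open>a < b\<close> by unfold_locales auto
  interpret oval_family a b t0 t1 r
    by (rule oval_family.intro) (use ovals family in auto)
  interpret o: oval a b "r ts" using ovals \<open>ts \<in> {t0<..<t1}\<close> by auto
  define \<sigma> where "\<sigma> = sgn (sqd3 (r ts) (q ts) \<tau>0)"
  have "sqd3 (r ts) (q ts) \<tau>0 \<noteq> 0"
    using general o.cusp_if_sqd3_0 meet by (auto simp: general_point_def)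
  then have pos: "\<sigma> * sqd3 (r ts) (q ts) \<tau>0 > 0"
    by (auto simp: \<sigma>_def sgn_if)
  have "continuous_on UNIV (\<lambda>x. \<sigma> * sqd3 (r ts) (q ts) x)"
    using \<open>ts \<in> {t0<..<t1}\<close> by (intro continuous_intros continuous_on_sqd(3)) auto
  then have "isCont (\<lambda>x. \<sigma> * sqd3 (r ts) (q ts) x) \<tau>0"
    by (simp add: continuous_on_eq_continuous_at)
  then have "\<forall>\<^sub>F x in nhds \<tau>0. \<sigma> * sqd3 (r ts) (q ts) x > 0"
    using tendsto_at_iff_tendsto_nhds[of "\<lambda>x. \<sigma> * sqd3 (r ts) (q ts) x" \<tau>0] order_tendstoD(1)[OF _ pos]
    by (simp add: isCont_def)
  then obtain d where d: "d > 0" "\<And>x. dist x \<tau>0 < d \<Longrightarrow> \<sigma> * sqd3 (r ts) (q ts) x > 0"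
    unfolding eventually_nhds_metric by blast
  define e where "e = min (d / 2) ((b - a) / 3)"
  interpret evolute_fold a b t0 t1 r ts \<tau>0 q e \<sigma>
  proof unfold_locales
    show "\<sigma> * sqd3 (r ts) (q ts) x > 0" if "x \<in> {\<tau>0-e..\<tau>0+e}" for x
      by (rule d(2)) (use that d(1) in \<open>auto simp: e_def dist_real_def\<close>)
    show "\<exists>k::int. y = \<tau>0 + of_int k * (b - a)" if "evolute (r ts) y = evolute (r ts) \<tau>0" for y
      using general that by (auto simp: general_point_def)
    have "e \<le> (b - a) / 3" unfolding e_def by (rule min.cobounded2)
    then show "2 * e < b - a" using \<open>a < b\<close> by (simp add: field_simps)
  qed (use path meet d(1) \<open>a < b\<close> \<open>ts \<in> {t0<..<t1}\<close> in \<open>auto simp: e_def\<close>)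
  obtain n L where 
    P: "\<And>F. F \<le> nhds ts \<Longrightarrow> \<forall>\<^sub>F t in F. q t \<in> inner_side t \<Longrightarrow>
      (\<forall>\<^sub>F t in F. equilibrium_number a b (r t) (q t) = n) \<and> ((\<lambda>t. N0 a b (r t) (q t)) \<longlongrightarrow> L) F"
    and N: "\<And>F. F \<le> nhds ts \<Longrightarrow> \<forall>\<^sub>F t in F. q t \<in> outer_side t \<Longrightarrow>
      (\<forall>\<^sub>F t in F. equilibrium_number a b (r t) (q t) = n + 2) \<and> filterlim (\<lambda>t. N0 a b (r t) (q t)) at_top F"
    using equilibria_near_fold by blast
  have le: "at ts within S \<le> nhds ts" for S by (rule at_within_le_nhds)
  have "\<forall>\<^sub>F t in at_left ts. q t \<in> inner_side t \<or> q t \<in> outer_side t" "\<forall>\<^sub>F t in at_right ts. q t \<in> inner_side t \<or> q t \<in> outer_side t"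
    using transversal crossing_convex_to_concave crossing_concave_to_convex
    unfolding transversely_intersects_def by (blast intro: eventually_mono)+
  then have "\<forall>\<^sub>F t in at ts. q t \<in> inner_side t \<or> q t \<in> outer_side t"
    by (simp add: eventually_at_split)
  from eventually_generic[OF le this] P[OF le] N[OF le]
    crossing_convex_to_concave crossing_concave_to_convex
  show ?thesis by blast
qed

end
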